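(* Let $R$ be a ring. (1) If $R$ is a left coherent ring and a left CF-ring, then $R$ is a left noetherian ring and a left Kasch ring. (2) If $R$ is a left noetherian ring and a left $IF$-ring, then $R$ is a left FGF-ring. If $R$ is a left coherent ring and a left FGF-ring, then $R$ is a left noetherian ring and a left $IF$-ring.
   Context: Rings are associative with unit, not necessarily commutative. - $R$ is left coherent if every finitely generated left ideal is finitely presented. - $R$ is a left CF-ring (respectively left FGF-ring, left $IF$-ring) if every cyclic (respectively finitely generated, finitely presented) left $R$-module embeds in a free left $R$-module. - $R$ is a left Kasch ring if the injective hull $E({}_RR)$ of ${}_RR$ is an injective cogenerator in the category of left $R$-modules; equivalently, $\mathrm{Hom}_R(M,R)\neq0$ for every non-zero cyclic left $R$-module $M$. *)

theory Defs
  imports "HOL-Algebra.Ring_Divisibility"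
begin

text \<open>
  The locale \<^locale>\<open>module\<close> requires a commutative ring of scalars, so left modules over
  an arbitrary unital ring are introduced here, on the same record type.  The \<open>mult\<close> and
  \<open>one\<close> fields of a module record carry no meaning.  The locale \<^locale>\<open>submodule\<close> does not
  depend on commutativity and is reused.
\<close>

locale left_module = R?: ring R + M?: abelian_group M
  for R :: "('a, 'r) ring_scheme" (structure) and M :: "('a, 'm, 's) module_scheme" (structure) +
  assumes smult_closed:
      "\<lbrakk>a \<in> carrier R; x \<in> carrier M\<rbrakk> \<Longrightarrow> a \<odot>\<^bsub>M\<^esub> x \<in> carrier M"
    and smult_l_distr:
      "\<lbrakk>a \<in> carrier R; b \<in> carrier R; x \<in> carrier M\<rbrakk> \<Longrightarrow>
        (a \<oplus>\<^bsub>R\<^esub> b) \<odot>\<^bsub>M\<^esub> x = a \<odot>\<^bsub>M\<^esub> x \<oplus>\<^bsub>M\<^esub> b \<odot>\<^bsub>M\<^esub> x"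
    and smult_r_distr:
      "\<lbrakk>a \<in> carrier R; x \<in> carrier M; y \<in> carrier M\<rbrakk> \<Longrightarrow>
        a \<odot>\<^bsub>M\<^esub> (x \<oplus>\<^bsub>M\<^esub> y) = a \<odot>\<^bsub>M\<^esub> x \<oplus>\<^bsub>M\<^esub> a \<odot>\<^bsub>M\<^esub> y"
    and smult_assoc:
      "\<lbrakk>a \<in> carrier R; b \<in> carrier R; x \<in> carrier M\<rbrakk> \<Longrightarrow>
        (a \<otimes>\<^bsub>R\<^esub> b) \<odot>\<^bsub>M\<^esub> x = a \<odot>\<^bsub>M\<^esub> (b \<odot>\<^bsub>M\<^esub> x)"
    and smult_one: "x \<in> carrier M \<Longrightarrow> \<one>\<^bsub>R\<^esub> \<odot>\<^bsub>M\<^esub> x = x"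

definition lmod_hom ::
  "('a, 'r) ring_scheme \<Rightarrow> ('a, 'm, 's) module_scheme \<Rightarrow> ('a, 'n, 't) module_scheme \<Rightarrow> ('m \<Rightarrow> 'n) set"
  where "lmod_hom R M N =
    {f \<in> hom (add_monoid M) (add_monoid N).
      \<forall>a\<in>carrier R. \<forall>x\<in>carrier M. f (a \<odot>\<^bsub>M\<^esub> x) = a \<odot>\<^bsub>N\<^esub> f x}"

definition lmod_kernel ::
  "('a, 'm, 's) module_scheme \<Rightarrow> ('a, 'n, 't) module_scheme \<Rightarrow> ('m \<Rightarrow> 'n) \<Rightarrow> 'm set"
  where "lmod_kernel M N f = {x \<in> carrier M. f x = \<zero>\<^bsub>N\<^esub>}"

definition lmod_span :: "('a, 'r) ring_scheme \<Rightarrow> ('a, 'm, 's) module_scheme \<Rightarrow> 'm set \<Rightarrow> 'm set"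
  where "lmod_span R M A = \<Inter>{H. submodule H R M \<and> A \<subseteq> H}"

definition cyclic_lmod :: "('a, 'r) ring_scheme \<Rightarrow> ('a, 'm, 's) module_scheme \<Rightarrow> bool"
  where "cyclic_lmod R M \<longleftrightarrow> (\<exists>x\<in>carrier M. carrier M = lmod_span R M {x})"

definition fin_gen_lmod :: "('a, 'r) ring_scheme \<Rightarrow> ('a, 'm, 's) module_scheme \<Rightarrow> bool"
  where "fin_gen_lmod R M \<longleftrightarrow>
    (\<exists>A. finite A \<and> A \<subseteq> carrier M \<and> carrier M = lmod_span R M A)"

definition regular_lmod :: "('a, 'r) ring_scheme \<Rightarrow> ('a, 'a) module"
  where "regular_lmod R =
    \<lparr>carrier = carrier R, monoid.mult = (\<otimes>\<^bsub>R\<^esub>), one = \<one>\<^bsub>R\<^esub>, ring.zero = \<zero>\<^bsub>R\<^esub>, ring.add = (\<oplus>\<^bsub>R\<^esub>),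
     smult = (\<otimes>\<^bsub>R\<^esub>)\<rparr>"

text \<open>The module \<open>R\<^sup>n\<close>: functions on \<open>nat\<close> that vanish from \<open>n\<close> on.\<close>

definition power_lmod :: "('a, 'r) ring_scheme \<Rightarrow> nat \<Rightarrow> ('a, nat \<Rightarrow> 'a) module"
  where "power_lmod R n =
    \<lparr>carrier = {v. (\<forall>i<n. v i \<in> carrier R) \<and> (\<forall>i\<ge>n. v i = \<zero>\<^bsub>R\<^esub>)},
     monoid.mult = (\<lambda>v w i. v i \<otimes>\<^bsub>R\<^esub> w i),
     one = (\<lambda>i. if i < n then \<one>\<^bsub>R\<^esub> else \<zero>\<^bsub>R\<^esub>),
     ring.zero = (\<lambda>i. \<zero>\<^bsub>R\<^esub>),
     ring.add = (\<lambda>v w i. v i \<oplus>\<^bsub>R\<^esub> w i),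
     smult = (\<lambda>a v i. a \<otimes>\<^bsub>R\<^esub> v i)\<rparr>"

definition fin_pres_lmod :: "('a, 'r) ring_scheme \<Rightarrow> ('a, 'm, 's) module_scheme \<Rightarrow> bool"
  where "fin_pres_lmod R M \<longleftrightarrow>
    (\<exists>n. \<exists>f\<in>lmod_hom R (power_lmod R n) M.
      f ` carrier (power_lmod R n) = carrier M \<and>
      fin_gen_lmod R ((power_lmod R n)\<lparr>carrier := lmod_kernel (power_lmod R n) M f\<rparr>))"

definition lmod_basis :: "('a, 'r) ring_scheme \<Rightarrow> ('a, 'f, 's) module_scheme \<Rightarrow> 'f set \<Rightarrow> bool"
  where "lmod_basis R F B \<longleftrightarrow> B \<subseteq> carrier F \<and>
    (\<forall>x\<in>carrier F. \<exists>!c. c \<in> B \<rightarrow> carrier R \<and> (\<forall>b. b \<notin> B \<longrightarrow> c b = \<zero>\<^bsub>R\<^esub>) \<and>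
      finite {b. c b \<noteq> \<zero>\<^bsub>R\<^esub>} \<and>
      x = (\<Oplus>\<^bsub>F\<^esub>b\<in>{b. c b \<noteq> \<zero>\<^bsub>R\<^esub>}. c b \<odot>\<^bsub>F\<^esub> b))"

definition free_lmod :: "('a, 'r) ring_scheme \<Rightarrow> ('a, 'f, 's) module_scheme \<Rightarrow> bool"
  where "free_lmod R F \<longleftrightarrow> left_module R F \<and> (\<exists>B. lmod_basis R F B)"

text \<open>
  A definition cannot quantify over types, so notions that speak about all modules take type
  tokens saying where the carriers of these modules live.  In \<open>left_CF_ring\<close>, \<open>left_FGF_ring\<close>
  and \<open>left_IF_ring\<close>, \<open>'m\<close> is the type of the modules to be embedded and \<open>'f\<close> that of the free
  modules receiving them.  Up to isomorphism, \<open>'m = 'a set\<close> already contains all cyclic left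
  modules \<open>R/I\<close>, and \<open>'m = (nat \<Rightarrow> 'a) set\<close> all finitely generated ones \<open>R\<^sup>n/K\<close>.  The image
  of such a module in a free module involves only finitely many basis elements, so
  \<open>'f = nat \<Rightarrow> 'a\<close>, containing all \<open>R\<^sup>n\<close>, is always large enough.  Hence, as a hypothesis,
  each notion is weakest at these \<open>'m\<close> and at arbitrary \<open>'f\<close>; as a conclusion it is strongest
  at arbitrary \<open>'m\<close> and at \<open>'f = nat \<Rightarrow> 'a\<close>.
\<close>

definition embeds_in_free ::
  "'f itself \<Rightarrow> ('a, 'r) ring_scheme \<Rightarrow> ('a, 'm, 's) module_scheme \<Rightarrow> bool"
  where "embeds_in_free TYPE('f) R M \<longleftrightarrow>
    (\<exists>(F :: ('a, 'f) module) f. free_lmod R F \<and> f \<in> lmod_hom R M F \<and> inj_on f (carrier M))"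

definition left_CF_ring :: "'m itself \<Rightarrow> 'f itself \<Rightarrow> ('a, 'r) ring_scheme \<Rightarrow> bool"
  where "left_CF_ring TYPE('m) TYPE('f) R \<longleftrightarrow>
    (\<forall>M :: ('a, 'm) module. left_module R M \<longrightarrow> cyclic_lmod R M \<longrightarrow> embeds_in_free TYPE('f) R M)"

definition left_FGF_ring :: "'m itself \<Rightarrow> 'f itself \<Rightarrow> ('a, 'r) ring_scheme \<Rightarrow> bool"
  where "left_FGF_ring TYPE('m) TYPE('f) R \<longleftrightarrow>
    (\<forall>M :: ('a, 'm) module. left_module R M \<longrightarrow> fin_gen_lmod R M \<longrightarrow> embeds_in_free TYPE('f) R M)"

definition left_IF_ring :: "'m itself \<Rightarrow> 'f itself \<Rightarrow> ('a, 'r) ring_scheme \<Rightarrow> bool"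
  where "left_IF_ring TYPE('m) TYPE('f) R \<longleftrightarrow>
    (\<forall>M :: ('a, 'm) module. left_module R M \<longrightarrow> fin_pres_lmod R M \<longrightarrow> embeds_in_free TYPE('f) R M)"

definition left_ideal :: "'a set \<Rightarrow> ('a, 'r) ring_scheme \<Rightarrow> bool"
  where "left_ideal I R \<longleftrightarrow> submodule I R (regular_lmod R)"

text \<open>The left-sided analogue of \<^locale>\<open>noetherian_ring\<close>.\<close>

definition left_noetherian :: "('a, 'r) ring_scheme \<Rightarrow> bool"
  where "left_noetherian R \<longleftrightarrow>
    (\<forall>I. left_ideal I R \<longrightarrow> fin_gen_lmod R ((regular_lmod R)\<lparr>carrier := I\<rparr>))"

definition left_coherent :: "('a, 'r) ring_scheme \<Rightarrow> bool"
  where "left_coherent R \<longleftrightarrow>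
    (\<forall>I. left_ideal I R \<longrightarrow> fin_gen_lmod R ((regular_lmod R)\<lparr>carrier := I\<rparr>) \<longrightarrow>
      fin_pres_lmod R ((regular_lmod R)\<lparr>carrier := I\<rparr>))"

definition injective_lmod ::
  "'m itself \<Rightarrow> ('a, 'r) ring_scheme \<Rightarrow> ('a, 'e, 's) module_scheme \<Rightarrow> bool"
  where "injective_lmod TYPE('m) R E \<longleftrightarrow> left_module R E \<and>
    (\<forall>(N :: ('a, 'm) module) K f.
      left_module R N \<longrightarrow> submodule K R N \<longrightarrow> f \<in> lmod_hom R (N\<lparr>carrier := K\<rparr>) E \<longrightarrow>
      (\<exists>g\<in>lmod_hom R N E. \<forall>x\<in>K. g x = f x))"

text \<open>An injective hull of \<open>M\<close>: an injective module with an essential embedding of \<open>M\<close>.\<close>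

definition injective_hull ::
  "'m itself \<Rightarrow> ('a, 'r) ring_scheme \<Rightarrow> ('a, 'n, 's) module_scheme \<Rightarrow> ('a, 'e, 't) module_scheme \<Rightarrow> bool"
  where "injective_hull TYPE('m) R M E \<longleftrightarrow> injective_lmod TYPE('m) R E \<and>
    (\<exists>i\<in>lmod_hom R M E. inj_on i (carrier M) \<and>
      (\<forall>H. submodule H R E \<longrightarrow> H \<noteq> {\<zero>\<^bsub>E\<^esub>} \<longrightarrow> H \<inter> i ` carrier M \<noteq> {\<zero>\<^bsub>E\<^esub>}))"

text \<open>Cogenerator in the categorical sense: the functor \<open>Hom(-, E)\<close> is faithful.\<close>

definition cogenerator_lmod ::
  "'m itself \<Rightarrow> ('a, 'r) ring_scheme \<Rightarrow> ('a, 'e, 's) module_scheme \<Rightarrow> bool"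
  where "cogenerator_lmod TYPE('m) R E \<longleftrightarrow> left_module R E \<and>
    (\<forall>(M :: ('a, 'm) module) (N :: ('a, 'm) module). \<forall>f\<in>lmod_hom R M N. \<forall>g\<in>lmod_hom R M N.
      left_module R M \<longrightarrow> left_module R N \<longrightarrow> (\<exists>x\<in>carrier M. f x \<noteq> g x) \<longrightarrow>
      (\<exists>h\<in>lmod_hom R N E. \<exists>x\<in>carrier M. h (f x) \<noteq> h (g x)))"

text \<open>
  The first conjunct says that the injective hull of the left regular module is an injective
  cogenerator.  It is universal over the hulls with carrier in \<open>'e\<close> (they are unique up to
  isomorphism), hence void when there is none in that type.  The second conjunct, the equivalent
  elementary description of left Kasch rings, mentions no hull and makes the notion
  meaningful for every \<open>'e\<close>.
\<close>

definition left_kasch_ring :: "'m itself \<Rightarrow> 'e itself \<Rightarrow> ('a, 'r) ring_scheme \<Rightarrow> bool"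
  where "left_kasch_ring TYPE('m) TYPE('e) R \<longleftrightarrow>
    (\<forall>E :: ('a, 'e) module. injective_hull TYPE('m) R (regular_lmod R) E \<longrightarrow>
      injective_lmod TYPE('m) R E \<and> cogenerator_lmod TYPE('m) R E) \<and>
    (\<forall>M :: ('a, 'm) module. left_module R M \<longrightarrow> cyclic_lmod R M \<longrightarrow> carrier M \<noteq> {\<zero>\<^bsub>M\<^esub>} \<longrightarrow>
      (\<exists>f\<in>lmod_hom R M (regular_lmod R). \<exists>x\<in>carrier M. f x \<noteq> \<zero>\<^bsub>R\<^esub>))"

end

theory Submission
  imports Defs
begin

text \<open>
  A finitely generated module that embeds in a free module embeds in some \<open>R\<^sup>k\<close>.  So over a left
  CF-ring every left ideal \<open>I\<close> is the kernel of a map \<open>R \<rightarrow> R\<^sup>k\<close>; imposing the \<open>k\<close> coordinate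
  equations one at a time, each image is a finitely generated left ideal, which is finitely
  presented by coherence, so the next kernel stays finitely generated and \<open>R\<close> is left noetherian.
  If \<open>M\<close> is cyclic, the embedding \<open>M \<cong> R/I \<rightarrow> R\<^sup>k\<close> followed by a coordinate detects any given
  non-zero element, which gives the Kasch property: to see that a hull \<open>E\<close> of \<open>R\<close> separates
  \<open>f\<close> and \<open>g\<close>, extend such a functional on \<open>R (f x - g x)\<close> to the whole module by injectivity.
  Finally, FGF-rings are CF-rings, and over a left noetherian ring finitely generated and finitely
  presented modules agree, so that there IF and FGF mean the same.
\<close>

section \<open>Left modules and their submodules\<close>

context left_module
begin

lemma smult_l_null: "x \<in> carrier M \<Longrightarrow> \<zero>\<^bsub>R\<^esub> \<odot>\<^bsub>M\<^esub> x = \<zero>\<^bsub>M\<^esub>"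
  using smult_l_distr[of "\<zero>\<^bsub>R\<^esub>" "\<zero>\<^bsub>R\<^esub>" x] smult_closed[of "\<zero>\<^bsub>R\<^esub>" x] M.add.r_cancel_one' by fastforce

lemma smult_r_null: "a \<in> carrier R \<Longrightarrow> a \<odot>\<^bsub>M\<^esub> \<zero>\<^bsub>M\<^esub> = \<zero>\<^bsub>M\<^esub>"
  using smult_r_distr[of a "\<zero>\<^bsub>M\<^esub>" "\<zero>\<^bsub>M\<^esub>"] smult_closed[of a "\<zero>\<^bsub>M\<^esub>"] M.add.r_cancel_one' by fastforce

text \<open>Negation is a scalar multiplication, so submodules and linear maps, being compatible
  with scalars, are compatible with negatives.\<close>

lemma smult_minus_one:
  assumes "x \<in> carrier M" shows "(\<ominus>\<^bsub>R\<^esub> \<one>\<^bsub>R\<^esub>) \<odot>\<^bsub>M\<^esub> x = \<ominus>\<^bsub>M\<^esub> x"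
proof -
  have "(\<ominus>\<^bsub>R\<^esub> \<one>\<^bsub>R\<^esub>) \<odot>\<^bsub>M\<^esub> x \<oplus>\<^bsub>M\<^esub> x = (\<ominus>\<^bsub>R\<^esub> \<one>\<^bsub>R\<^esub> \<oplus>\<^bsub>R\<^esub> \<one>\<^bsub>R\<^esub>) \<odot>\<^bsub>M\<^esub> x"
    using assms by (simp add: smult_l_distr smult_one)
  then show ?thesis
    using assms by (simp add: R.l_neg smult_l_null smult_closed M.minus_equality)
qed

lemma submoduleI:
  assumes "H \<subseteq> carrier M" "\<zero>\<^bsub>M\<^esub> \<in> H"
    and "\<And>x y. \<lbrakk>x \<in> H; y \<in> H\<rbrakk> \<Longrightarrow> x \<oplus>\<^bsub>M\<^esub> y \<in> H"
    and "\<And>a x. \<lbrakk>a \<in> carrier R; x \<in> H\<rbrakk> \<Longrightarrow> a \<odot>\<^bsub>M\<^esub> x \<in> H"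
  shows "submodule H R M"
proof -
  have "\<ominus>\<^bsub>M\<^esub> x \<in> H" if "x \<in> H" for x
    using assms(1) assms(4)[of "\<ominus>\<^bsub>R\<^esub> \<one>\<^bsub>R\<^esub>" x] that smult_minus_one[of x] by auto
  with assms show ?thesis
    by (intro submodule.intro subgroup.intro submodule_axioms.intro) (auto simp flip: a_inv_def)
qed

lemma submoduleD:
  assumes "submodule H R M"
  shows "H \<subseteq> carrier M" "\<zero>\<^bsub>M\<^esub> \<in> H"
    and "\<And>x y. \<lbrakk>x \<in> H; y \<in> H\<rbrakk> \<Longrightarrow> x \<oplus>\<^bsub>M\<^esub> y \<in> H"
    and "\<And>a x. \<lbrakk>a \<in> carrier R; x \<in> H\<rbrakk> \<Longrightarrow> a \<odot>\<^bsub>M\<^esub> x \<in> H"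
    and "\<And>x. x \<in> H \<Longrightarrow> \<ominus>\<^bsub>M\<^esub> x \<in> H"
proof -
  interpret submodule H R M by fact
  show "H \<subseteq> carrier M" "\<zero>\<^bsub>M\<^esub> \<in> H" "\<And>x y. \<lbrakk>x \<in> H; y \<in> H\<rbrakk> \<Longrightarrow> x \<oplus>\<^bsub>M\<^esub> y \<in> H"
    "\<And>a x. \<lbrakk>a \<in> carrier R; x \<in> H\<rbrakk> \<Longrightarrow> a \<odot>\<^bsub>M\<^esub> x \<in> H"
    using subset one_closed m_closed smult_closed by auto
  show "\<ominus>\<^bsub>M\<^esub> x \<in> H" if "x \<in> H" for x
    using m_inv_closed that by (simp add: a_inv_def)
qed

lemma minus_eq_zero_iff:
  "\<lbrakk>x \<in> carrier M; y \<in> carrier M\<rbrakk> \<Longrightarrow> x \<ominus>\<^bsub>M\<^esub> y = \<zero>\<^bsub>M\<^esub> \<longleftrightarrow> x = y"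
  by (metis a_minus_def M.add.inv_closed M.minus_equality M.r_neg M.minus_minus)

lemma submodule_minus:
  "\<lbrakk>submodule H R M; x \<in> H; y \<in> H\<rbrakk> \<Longrightarrow> x \<ominus>\<^bsub>M\<^esub> y \<in> H"
  by (simp add: a_minus_def submoduleD)

lemma carrier_submodule: "submodule (carrier M) R M"
  by (rule submoduleI) (auto simp: smult_closed)

lemma zero_submodule: "submodule {\<zero>\<^bsub>M\<^esub>} R M"
  by (rule submoduleI) (auto simp: smult_r_null)

lemma submodule_Int:
  assumes "submodule H R M" "submodule K R M"
  shows "submodule (H \<inter> K) R M"
  using submoduleD(1-4)[OF assms(1)] submoduleD(1-4)[OF assms(2)]
  by (intro submoduleI) (simp_all add: le_infI1)

lemma submodule_left_module:
  assumes "submodule H R M"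
  shows "left_module R (M\<lparr>carrier := H\<rparr>)"
proof -
  note H = submoduleD[OF assms]
  have "abelian_group (M\<lparr>carrier := H\<rparr>)"
  proof (rule abelian_groupI)
    fix x assume "x \<in> carrier (M\<lparr>carrier := H\<rparr>)"
    then show "\<exists>y\<in>carrier (M\<lparr>carrier := H\<rparr>). y \<oplus>\<^bsub>M\<lparr>carrier := H\<rparr>\<^esub> x = \<zero>\<^bsub>M\<lparr>carrier := H\<rparr>\<^esub>"
      using H by (auto intro!: bexI[of _ "\<ominus>\<^bsub>M\<^esub> x"] simp: M.l_neg subsetD)
  qed (use H in \<open>auto simp: M.a_ac subsetD\<close>)
  then show ?thesis
    using H R.ring_axioms
    by (auto intro!: left_module.intro left_module_axioms.intro
        simp: smult_l_distr smult_r_distr smult_assoc smult_one subsetD)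
qed

lemma submodule_restrict_iff:
  assumes "submodule K R M"
  shows "submodule H R (M\<lparr>carrier := K\<rparr>) \<longleftrightarrow> submodule H R M \<and> H \<subseteq> K"
proof -
  interpret K: left_module R "M\<lparr>carrier := K\<rparr>" using assms by (rule submodule_left_module)
  note K = submoduleD(1)[OF assms]
  show ?thesis
  proof
    assume "submodule H R (M\<lparr>carrier := K\<rparr>)"
    note H = K.submoduleD(1-4)[OF this, simplified]
    show "submodule H R M \<and> H \<subseteq> K" using H K by (simp add: submoduleI)
  next
    assume H: "submodule H R M \<and> H \<subseteq> K"
    with submoduleD(1-4)[of H] show "submodule H R (M\<lparr>carrier := K\<rparr>)"
      by (intro K.submoduleI) simp_all
  qed
qed

section \<open>Spans and finite generation of submodules\<close>

lemma span_submodule: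
  assumes "A \<subseteq> carrier M" shows "submodule (lmod_span R M A) R M"
proof (rule submoduleI)
  show "lmod_span R M A \<subseteq> carrier M"
    using carrier_submodule assms by (auto simp: lmod_span_def)
qed (auto simp: lmod_span_def submoduleD)

lemma span_superset: "A \<subseteq> lmod_span R M A"
  by (auto simp: lmod_span_def)

lemma span_minimal: "\<lbrakk>submodule H R M; A \<subseteq> H\<rbrakk> \<Longrightarrow> lmod_span R M A \<subseteq> H"
  by (auto simp: lmod_span_def)

lemma span_restrict:
  assumes "submodule K R M" "A \<subseteq> K"
  shows "lmod_span R (M\<lparr>carrier := K\<rparr>) A = lmod_span R M A"
proof -
  have "A \<subseteq> carrier M" using assms submoduleD(1) by auto
  then have "lmod_span R M A \<in> {H. submodule H R (M\<lparr>carrier := K\<rparr>) \<and> A \<subseteq> H}"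
    using assms span_submodule span_superset span_minimal by (simp add: submodule_restrict_iff)
  moreover have "lmod_span R M A \<subseteq> lmod_span R (M\<lparr>carrier := K\<rparr>) A"
    using assms by (auto simp: lmod_span_def submodule_restrict_iff)
  ultimately show ?thesis by (auto simp: lmod_span_def)
qed

text \<open>\<open>fin_gen_lmod\<close> of a restricted record speaks of spans formed inside
  \<open>K\<close>. By \<open>span_restrict\<close> the generators may be treated in the ambient
  \<open>M\<close>, which suits kernels, images and ideals given as subsets of
  \<open>M\<close>.\<close>

lemma fin_gen_submodule_iff:
  assumes "submodule K R M"
  shows "fin_gen_lmod R (M\<lparr>carrier := K\<rparr>) \<longleftrightarrow>
    (\<exists>A. finite A \<and> A \<subseteq> carrier M \<and> K = lmod_span R M A)"
proof
  assume "fin_gen_lmod R (M\<lparr>carrier := K\<rparr>)"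
  then obtain A where "finite A" "A \<subseteq> K" "K = lmod_span R (M\<lparr>carrier := K\<rparr>) A"
    by (auto simp: fin_gen_lmod_def)
  then show "\<exists>A. finite A \<and> A \<subseteq> carrier M \<and> K = lmod_span R M A"
    using submoduleD(1)[OF assms] span_restrict[OF assms] by (intro exI[of _ A]) simp
next
  assume "\<exists>A. finite A \<and> A \<subseteq> carrier M \<and> K = lmod_span R M A"
  then obtain A where A: "finite A" "K = lmod_span R M A" by blast
  then have "A \<subseteq> K" using span_superset by simp
  with A show "fin_gen_lmod R (M\<lparr>carrier := K\<rparr>)"
    using span_restrict[OF assms] by (auto simp: fin_gen_lmod_def)
qed

lemma smult_image_submodule:
  assumes "x \<in> carrier M"
  shows "submodule ((\<lambda>a. a \<odot>\<^bsub>M\<^esub> x) ` carrier R) R M"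
proof (rule submoduleI)
  show "\<zero>\<^bsub>M\<^esub> \<in> (\<lambda>a. a \<odot>\<^bsub>M\<^esub> x) ` carrier R"
    using assms smult_l_null by (auto intro!: image_eqI[of _ _ "\<zero>\<^bsub>R\<^esub>"])
qed (use assms in \<open>auto simp: smult_closed simp flip: smult_l_distr smult_assoc\<close>)

lemma span_singleton:
  assumes "x \<in> carrier M"
  shows "lmod_span R M {x} = (\<lambda>a. a \<odot>\<^bsub>M\<^esub> x) ` carrier R"
proof
  have "x \<in> (\<lambda>a. a \<odot>\<^bsub>M\<^esub> x) ` carrier R"
    using assms smult_one by (auto intro!: image_eqI[of _ _ "\<one>\<^bsub>R\<^esub>"])
  then show "lmod_span R M {x} \<subseteq> (\<lambda>a. a \<odot>\<^bsub>M\<^esub> x) ` carrier R"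
    using assms smult_image_submodule by (intro span_minimal) auto
  show "(\<lambda>a. a \<odot>\<^bsub>M\<^esub> x) ` carrier R \<subseteq> lmod_span R M {x}"
    using assms submoduleD(4)[OF span_submodule] span_superset[of "{x}"] by blast
qed

lemma cyclic_imp_fin_gen: "cyclic_lmod R M \<Longrightarrow> fin_gen_lmod R M"
  unfolding cyclic_lmod_def fin_gen_lmod_def by (metis empty_subsetI finite.emptyI finite.insertI insert_subset)

end

section \<open>Homomorphisms\<close>

lemma lmod_homI:
  assumes "\<And>x. x \<in> carrier M \<Longrightarrow> f x \<in> carrier N"
    and "\<And>x y. \<lbrakk>x \<in> carrier M; y \<in> carrier M\<rbrakk> \<Longrightarrow> f (x \<oplus>\<^bsub>M\<^esub> y) = f x \<oplus>\<^bsub>N\<^esub> f y"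
    and "\<And>a x. \<lbrakk>a \<in> carrier R; x \<in> carrier M\<rbrakk> \<Longrightarrow> f (a \<odot>\<^bsub>M\<^esub> x) = a \<odot>\<^bsub>N\<^esub> f x"
  shows "f \<in> lmod_hom R M N"
  using assms by (auto simp: lmod_hom_def hom_def)

locale left_module_hom = dom: left_module R M + cod: left_module R N
  for R :: "('a, 'r) ring_scheme" and M :: "('a, 'm, 's) module_scheme"
    and N :: "('a, 'n, 't) module_scheme" +
  fixes f assumes hom: "f \<in> lmod_hom R M N"
begin

lemma hom_closed: "x \<in> carrier M \<Longrightarrow> f x \<in> carrier N"
  and hom_add: "\<lbrakk>x \<in> carrier M; y \<in> carrier M\<rbrakk> \<Longrightarrow> f (x \<oplus>\<^bsub>M\<^esub> y) = f x \<oplus>\<^bsub>N\<^esub> f y"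
  and hom_smult: "\<lbrakk>a \<in> carrier R; x \<in> carrier M\<rbrakk> \<Longrightarrow> f (a \<odot>\<^bsub>M\<^esub> x) = a \<odot>\<^bsub>N\<^esub> f x"
  using hom by (auto simp: lmod_hom_def hom_def)

lemma hom_zero: "f \<zero>\<^bsub>M\<^esub> = \<zero>\<^bsub>N\<^esub>"
  using hom_smult[of "\<zero>\<^bsub>R\<^esub>" "\<zero>\<^bsub>M\<^esub>"] by (simp add: dom.smult_l_null cod.smult_l_null hom_closed)

lemma hom_uminus: "x \<in> carrier M \<Longrightarrow> f (\<ominus>\<^bsub>M\<^esub> x) = \<ominus>\<^bsub>N\<^esub> f x"
  using hom_smult[of "\<ominus>\<^bsub>R\<^esub> \<one>\<^bsub>R\<^esub>" x] by (simp add: dom.smult_minus_one cod.smult_minus_one hom_closed)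

lemma hom_minus: "\<lbrakk>x \<in> carrier M; y \<in> carrier M\<rbrakk> \<Longrightarrow> f (x \<ominus>\<^bsub>M\<^esub> y) = f x \<ominus>\<^bsub>N\<^esub> f y"
  by (simp add: a_minus_def hom_add hom_uminus)

lemma hom_finsum:
  assumes "h \<in> I \<rightarrow> carrier M" shows "f (\<Oplus>\<^bsub>M\<^esub>i\<in>I. h i) = (\<Oplus>\<^bsub>N\<^esub>i\<in>I. f (h i))"
  using assms
proof (induction I rule: infinite_finite_induct)
  case (insert i I)
  then have "h \<in> I \<rightarrow> carrier M" "h i \<in> carrier M" "(\<lambda>i. f (h i)) \<in> I \<rightarrow> carrier N"
    using hom_closed by auto
  with insert show ?case by (simp add: hom_add hom_closed)
\<comment> \<open>An infinite sum is zero by convention, so this case, like the empty one, reduces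
  to \<open>hom_zero\<close>.\<close>
qed (simp_all add: hom_zero)

lemma image_submodule:
  assumes "submodule K R M" shows "submodule (f ` K) R N"
proof -
  note K = dom.submoduleD[OF assms]
  show ?thesis
  proof (rule cod.submoduleI)
    show "f ` K \<subseteq> carrier N" using K hom_closed by auto
    show "\<zero>\<^bsub>N\<^esub> \<in> f ` K" using K(2) hom_zero by (metis imageI)
    show "x \<oplus>\<^bsub>N\<^esub> y \<in> f ` K" if "x \<in> f ` K" "y \<in> f ` K" for x y
      using that K(3) subsetD[OF K(1)] by (auto simp flip: hom_add)
    show "a \<odot>\<^bsub>N\<^esub> x \<in> f ` K" if "a \<in> carrier R" "x \<in> f ` K" for a x
      using that K(4) subsetD[OF K(1)] by (auto simp flip: hom_smult)
  qed
qed

lemma vimage_submodule: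
  assumes "submodule H R N" shows "submodule {x \<in> carrier M. f x \<in> H} R M"
  using cod.submoduleD[OF assms]
  by (intro dom.submoduleI) (auto simp: hom_add hom_smult hom_zero dom.smult_closed)

lemma kernel_submodule: "submodule (lmod_kernel M N f) R M"
  using vimage_submodule[OF cod.zero_submodule] by (simp add: lmod_kernel_def)

lemma eq_iff_diff_in_kernel:
  assumes "x \<in> carrier M" "y \<in> carrier M"
  shows "f x = f y \<longleftrightarrow> x \<ominus>\<^bsub>M\<^esub> y \<in> lmod_kernel M N f"
  using assms by (simp add: lmod_kernel_def hom_minus hom_closed cod.minus_eq_zero_iff)

lemma image_span:
  assumes "A \<subseteq> carrier M"
  shows "f ` lmod_span R M A = lmod_span R N (f ` A)"
proof
  have fA: "f ` A \<subseteq> carrier N" using assms hom_closed by auto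
  show "lmod_span R N (f ` A) \<subseteq> f ` lmod_span R M A"
    using image_submodule dom.span_submodule[OF assms] dom.span_superset
    by (intro cod.span_minimal) auto
  \<comment> \<open>The preimage of a submodule is a submodule, and this one contains
    \<open>A\<close>.\<close>
  have "lmod_span R M A \<subseteq> {x \<in> carrier M. f x \<in> lmod_span R N (f ` A)}"
    using assms cod.span_superset[of "f ` A"]
    by (intro dom.span_minimal vimage_submodule cod.span_submodule fA) auto
  then show "f ` lmod_span R M A \<subseteq> lmod_span R N (f ` A)" by auto
qed

lemma fin_gen_image:
  assumes "fin_gen_lmod R M" "f ` carrier M = carrier N"
  shows "fin_gen_lmod R N"
proof -
  obtain A where "finite A" "A \<subseteq> carrier M" "carrier M = lmod_span R M A"
    using assms(1) by (auto simp: fin_gen_lmod_def)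
  then have "finite (f ` A)" "f ` A \<subseteq> carrier N" "carrier N = lmod_span R N (f ` A)"
    using image_span[of A] assms(2) by auto
  then show ?thesis unfolding fin_gen_lmod_def by blast
qed

lemma cyclic_image:
  assumes "cyclic_lmod R M" "f ` carrier M = carrier N"
  shows "cyclic_lmod R N"
proof -
  obtain x where "x \<in> carrier M" "carrier M = lmod_span R M {x}"
    using assms(1) by (auto simp: cyclic_lmod_def)
  then have "f x \<in> carrier N" "carrier N = lmod_span R N {f x}"
    using image_span[of "{x}"] assms(2) hom_closed by auto
  then show ?thesis unfolding cyclic_lmod_def by blast
qed

text \<open>Generators of the kernel part, together with arbitrary lifts of generators of the image,
  generate \<open>K\<close>. This is the inductive step for climbing a filtration.\<close>

lemma fin_gen_submodule_extension:
  assumes K: "submodule K R M"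
    and im: "fin_gen_lmod R (N\<lparr>carrier := f ` K\<rparr>)"
    and ker: "fin_gen_lmod R (M\<lparr>carrier := K \<inter> lmod_kernel M N f\<rparr>)"
  shows "fin_gen_lmod R (M\<lparr>carrier := K\<rparr>)"
proof -
  have kerK: "submodule (K \<inter> lmod_kernel M N f) R M"
    using K kernel_submodule by (rule dom.submodule_Int)
  obtain B where B: "finite B" "f ` K = lmod_span R N B"
    using im image_submodule[OF K] by (auto simp: cod.fin_gen_submodule_iff)
  then have "B \<subseteq> f ` K" using cod.span_superset by simp
  then obtain B' where B': "B' \<subseteq> K" "finite B'" "B = f ` B'"
    using B(1) by (meson finite_subset_image)
  obtain A where A: "finite A" "K \<inter> lmod_kernel M N f = lmod_span R M A"
    using ker kerK by (auto simp: dom.fin_gen_submodule_iff)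
  have AK: "A \<subseteq> K" using A(2) dom.span_superset by blast
  let ?H = "lmod_span R M (A \<union> B')"
  have AB: "A \<union> B' \<subseteq> carrier M" using AK B' dom.submoduleD(1)[OF K] by auto
  note H = dom.span_submodule[OF AB]
  have "K \<subseteq> ?H"
  proof
    fix x assume x: "x \<in> K"
    have "B' \<subseteq> carrier M" using AB by auto
    then have "f ` K = f ` lmod_span R M B'" using B B' image_span by auto
    then obtain y where y: "y \<in> lmod_span R M B'" "f x = f y" using x by blast
    have "lmod_span R M B' \<subseteq> K" using dom.span_minimal[OF K B'(1)] .
    then have yK: "y \<in> K" using y by auto
    have "x \<in> carrier M" "y \<in> carrier M" using x yK dom.submoduleD(1)[OF K] by auto
    then have "x \<ominus>\<^bsub>M\<^esub> y \<in> lmod_span R M A"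
      using A(2) y(2) x yK dom.submodule_minus[OF K] eq_iff_diff_in_kernel by blast
    moreover have "lmod_span R M A \<subseteq> ?H" "lmod_span R M B' \<subseteq> ?H"
      using H dom.span_superset[of "A \<union> B'"] by (simp_all add: dom.span_minimal)
    ultimately have "(x \<ominus>\<^bsub>M\<^esub> y) \<oplus>\<^bsub>M\<^esub> y \<in> ?H"
      using H y dom.submoduleD(3) by blast
    then show "x \<in> ?H"
      using \<open>x \<in> carrier M\<close> \<open>y \<in> carrier M\<close> by (simp add: a_minus_def dom.M.a_assoc dom.M.l_neg)
  qed
  moreover have "?H \<subseteq> K" using AK B' K by (intro dom.span_minimal) auto
  ultimately have "K = ?H" by blast
  then show ?thesis using A B' AB K by (auto simp: dom.fin_gen_submodule_iff)
qed

end

lemma lmod_hom_comp: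
  "\<lbrakk>f \<in> lmod_hom R M N; g \<in> lmod_hom R N P\<rbrakk> \<Longrightarrow> g \<circ> f \<in> lmod_hom R M P"
  by (auto simp: lmod_hom_def hom_def Pi_def)

text \<open>The first isomorphism theorem without quotients: \<open>N\<close> is \<open>M\<close>
  modulo the common kernel, and \<open>g\<close> descends to it. Later this carries an embedding of
  a quotient module over to an isomorphic module whose elements live in another type.\<close>

lemma (in left_module_hom) factor_through_surjection:
  assumes "left_module R P" and surj: "f ` carrier M = carrier N"
    and g: "g \<in> lmod_hom R M P" and ker: "lmod_kernel M P g = lmod_kernel M N f"
  obtains h where "h \<in> lmod_hom R N P" "inj_on h (carrier N)"
    "\<And>x. x \<in> carrier M \<Longrightarrow> h (f x) = g x"
proof -
  interpret P: left_module R P by fact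
  interpret g: left_module_hom R M P g by unfold_locales (rule g)
  \<comment> \<open>Any preimage of \<open>y\<close> will do: two of them differ by an element of
    the kernel of \<open>f\<close>, which \<open>g\<close> kills.\<close>
  define h where "h y = g (inv_into (carrier M) f y)" for y
  have h: "h (f x) = g x" if x: "x \<in> carrier M" for x
  proof -
    let ?x' = "inv_into (carrier M) f (f x)"
    have "f ?x' = f x" "?x' \<in> carrier M" using x by (simp_all add: f_inv_into_f inv_into_into)
    then show ?thesis
      using x ker by (simp add: h_def g.eq_iff_diff_in_kernel eq_iff_diff_in_kernel)
  qed
  have "h \<in> lmod_hom R N P"
    unfolding surj[symmetric]
  proof (rule lmod_homI)
    fix y assume "y \<in> carrier N"
    then obtain x where x: "x \<in> carrier M" "y = f x" using surj by blast
    then show "h y \<in> carrier P" by (simp add: h g.hom_closed)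
    fix a assume "a \<in> carrier R"
    then show "h (a \<odot>\<^bsub>N\<^esub> y) = a \<odot>\<^bsub>P\<^esub> h y"
      using x h dom.smult_closed by (simp add: g.hom_smult flip: hom_smult)
  next
    fix y z assume "y \<in> carrier N" "z \<in> carrier N"
    then obtain x w where "x \<in> carrier M" "y = f x" "w \<in> carrier M" "z = f w"
      using surj by (metis imageE)
    then show "h (y \<oplus>\<^bsub>N\<^esub> z) = h y \<oplus>\<^bsub>P\<^esub> h z"
      by (simp add: h g.hom_add flip: hom_add)
  qed
  \<comment> \<open>Injectivity comes from the other inclusion of kernels: what \<open>g\<close>
    kills is killed by \<open>f\<close>.\<close>
  moreover have "inj_on h (carrier N)"
  proof (rule inj_onI)
    fix y z assume "y \<in> carrier N" "z \<in> carrier N" and eq: "h y = h z"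
    then obtain x w where "x \<in> carrier M" "y = f x" "w \<in> carrier M" "z = f w"
      using surj by (metis imageE)
    with eq show "y = z"
      using ker by (simp add: h g.eq_iff_diff_in_kernel eq_iff_diff_in_kernel)
  qed
  ultimately show ?thesis using h that by blast
qed

section \<open>Quotient modules\<close>

text \<open>Cosets form the carrier, so \<open>R/I\<close> has its elements in \<open>'a set\<close>
  and \<open>R^n/K\<close> in \<open>(nat \<Rightarrow> 'a) set\<close>. \<open>smult\<close> takes
  the union over all representatives instead of choosing one; \<open>mult\<close> and
  \<open>one\<close> are dummies.\<close>

definition quot_lmod :: "('a, 'm, 's) module_scheme \<Rightarrow> 'm set \<Rightarrow> ('a, 'm set) module"
  where "quot_lmod M K =
    \<lparr>carrier = a_rcosets\<^bsub>M\<^esub> K, monoid.mult = (\<lambda>X Y. K), one = K, ring.zero = K,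
     ring.add = (<+>\<^bsub>M\<^esub>), smult = (\<lambda>a X. \<Union>x\<in>X. K +>\<^bsub>M\<^esub> (a \<odot>\<^bsub>M\<^esub> x))\<rparr>"

context left_module
begin

lemma submodule_abelian_subgroup:
  "submodule K R M \<Longrightarrow> abelian_subgroup K M"
  by (intro abelian_subgroupI3 additive_subgroupI) (simp_all add: submodule_def M.abelian_group_axioms)

context
  fixes K assumes K: "submodule K R M"
begin

interpretation K: abelian_subgroup K M
  using K by (rule submodule_abelian_subgroup)

lemma carrier_quot_lmod: "carrier (quot_lmod M K) = (\<lambda>x. K +>\<^bsub>M\<^esub> x) ` carrier M"
  by (auto simp: quot_lmod_def A_RCOSETS_def')

lemma zero_quot_lmod: "\<zero>\<^bsub>quot_lmod M K\<^esub> = K +>\<^bsub>M\<^esub> \<zero>\<^bsub>M\<^esub>"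
  using K.a_subset by (simp add: quot_lmod_def)

lemma add_quot_lmod:
  "\<lbrakk>x \<in> carrier M; y \<in> carrier M\<rbrakk> \<Longrightarrow>
    (K +>\<^bsub>M\<^esub> x) \<oplus>\<^bsub>quot_lmod M K\<^esub> (K +>\<^bsub>M\<^esub> y) = K +>\<^bsub>M\<^esub> (x \<oplus>\<^bsub>M\<^esub> y)"
  by (simp add: quot_lmod_def K.a_rcos_sum)

lemma smult_quot_lmod:
  assumes "a \<in> carrier R" "x \<in> carrier M"
  shows "a \<odot>\<^bsub>quot_lmod M K\<^esub> (K +>\<^bsub>M\<^esub> x) = K +>\<^bsub>M\<^esub> (a \<odot>\<^bsub>M\<^esub> x)"
proof -
  \<comment> \<open>Two representatives differ by some \<open>k \<in> K\<close>, and
    \<open>a k\<close> stays in \<open>K\<close>, so every member of the union is the same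
    coset.\<close>
  have eq: "K +>\<^bsub>M\<^esub> (a \<odot>\<^bsub>M\<^esub> y) = K +>\<^bsub>M\<^esub> (a \<odot>\<^bsub>M\<^esub> x)" if y: "y \<in> K +>\<^bsub>M\<^esub> x" for y
  proof -
    obtain k where k: "k \<in> K" "y = k \<oplus>\<^bsub>M\<^esub> x" using y by (auto simp: a_r_coset_def')
    then have "a \<odot>\<^bsub>M\<^esub> y = a \<odot>\<^bsub>M\<^esub> k \<oplus>\<^bsub>M\<^esub> a \<odot>\<^bsub>M\<^esub> x" "a \<odot>\<^bsub>M\<^esub> k \<in> K"
      using assms K submoduleD by (auto simp: smult_r_distr)
    then have "a \<odot>\<^bsub>M\<^esub> y \<in> K +>\<^bsub>M\<^esub> (a \<odot>\<^bsub>M\<^esub> x)" by (auto simp: a_r_coset_def')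
    then show ?thesis using assms by (intro K.a_repr_independence'[symmetric]) (simp_all add: smult_closed)
  qed
  have "a \<odot>\<^bsub>quot_lmod M K\<^esub> (K +>\<^bsub>M\<^esub> x) = (\<Union>y\<in>K +>\<^bsub>M\<^esub> x. K +>\<^bsub>M\<^esub> (a \<odot>\<^bsub>M\<^esub> y))"
    by (simp add: quot_lmod_def)
  also have "\<dots> = (\<Union>y\<in>K +>\<^bsub>M\<^esub> x. K +>\<^bsub>M\<^esub> (a \<odot>\<^bsub>M\<^esub> x))"
    using eq by (intro SUP_cong) blast+
  \<comment> \<open>The union of a constant family is that constant because the index set contains
    \<open>x\<close>.\<close>
  also have "\<dots> = K +>\<^bsub>M\<^esub> (a \<odot>\<^bsub>M\<^esub> x)"
    using K.a_rcos_self[of x] assms by auto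
  finally show ?thesis .
qed

lemma quot_left_module: "left_module R (quot_lmod M K)"
proof -
  have "abelian_group (quot_lmod M K)"
  proof (rule abelian_groupI)
    fix X assume "X \<in> carrier (quot_lmod M K)"
    then obtain x where "x \<in> carrier M" "X = K +>\<^bsub>M\<^esub> x" by (auto simp: carrier_quot_lmod)
    then show "\<exists>Y\<in>carrier (quot_lmod M K). Y \<oplus>\<^bsub>quot_lmod M K\<^esub> X = \<zero>\<^bsub>quot_lmod M K\<^esub>"
      by (auto simp: carrier_quot_lmod zero_quot_lmod add_quot_lmod M.l_neg
          intro!: bexI[of _ "\<ominus>\<^bsub>M\<^esub> x"])
  qed (auto simp: carrier_quot_lmod add_quot_lmod zero_quot_lmod M.a_ac)
  then show ?thesis
    by (auto intro!: left_module.intro left_module_axioms.intro R.ring_axioms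
      simp: carrier_quot_lmod add_quot_lmod smult_quot_lmod smult_closed smult_l_distr smult_r_distr
        smult_assoc smult_one)
qed

lemma quot_hom: "(\<lambda>x. K +>\<^bsub>M\<^esub> x) \<in> lmod_hom R M (quot_lmod M K)"
  by (rule lmod_homI) (auto simp: carrier_quot_lmod add_quot_lmod smult_quot_lmod)

lemma quot_kernel: "lmod_kernel M (quot_lmod M K) (\<lambda>x. K +>\<^bsub>M\<^esub> x) = K"
proof -
  have "K +>\<^bsub>M\<^esub> x = K \<longleftrightarrow> x \<in> K" if "x \<in> carrier M" for x
    using that K.a_subgroup M.a_coset_join2 K.a_rcos_self by metis
  then show ?thesis
    using K.a_subset by (auto simp: lmod_kernel_def zero_quot_lmod)
qed

end

end

section \<open>The modules \<open>R\<^sup>n\<close>\<close>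

text \<open>The length is not recorded: one function serves every power and lies in
  \<open>power_lmod R n\<close> whenever \<open>i < n\<close>.\<close>

definition std_vec :: "('a, 'r) ring_scheme \<Rightarrow> nat \<Rightarrow> nat \<Rightarrow> 'a"
  where "std_vec R i = (\<lambda>j. if i = j then \<one>\<^bsub>R\<^esub> else \<zero>\<^bsub>R\<^esub>)"

context ring
begin

lemma regular_left_module: "left_module R (regular_lmod R)"
proof -
  have "abelian_group (regular_lmod R)"
    by (rule abelian_groupI)
      (auto simp: regular_lmod_def a_ac intro!: bexI[of _ "\<ominus> _"] l_neg)
  then show ?thesis
    by (auto intro!: left_module.intro left_module_axioms.intro ring_axioms
        simp: regular_lmod_def l_distr r_distr m_assoc)
qed

text \<open>Entries from \<open>n\<close> on are zero, hence in \<open>R\<close> too, which makes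
  the claim available for every index.\<close>

lemma coord_closed: "v \<in> carrier (power_lmod R n) \<Longrightarrow> v i \<in> carrier R"
  by (cases "i < n") (auto simp: power_lmod_def)

lemma power_left_module: "left_module R (power_lmod R n)"
proof -
  have "abelian_group (power_lmod R n)"
  proof (rule abelian_groupI)
    fix v assume "v \<in> carrier (power_lmod R n)"
    then show "\<exists>w\<in>carrier (power_lmod R n). w \<oplus>\<^bsub>power_lmod R n\<^esub> v = \<zero>\<^bsub>power_lmod R n\<^esub>"
      using coord_closed[of v n]
      by (intro bexI[of _ "\<lambda>i. \<ominus> v i"]) (simp_all add: power_lmod_def fun_eq_iff l_neg)
  next
    fix v w u assume "v \<in> carrier (power_lmod R n)" "w \<in> carrier (power_lmod R n)"
      "u \<in> carrier (power_lmod R n)"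
    then have "v i \<in> carrier R" "w i \<in> carrier R" "u i \<in> carrier R" for i
      using coord_closed by blast+
    then show
      "v \<oplus>\<^bsub>power_lmod R n\<^esub> w \<oplus>\<^bsub>power_lmod R n\<^esub> u = v \<oplus>\<^bsub>power_lmod R n\<^esub> (w \<oplus>\<^bsub>power_lmod R n\<^esub> u)"
      "v \<oplus>\<^bsub>power_lmod R n\<^esub> w = w \<oplus>\<^bsub>power_lmod R n\<^esub> v"
      by (auto simp: power_lmod_def fun_eq_iff a_ac)
  next
    fix v assume "v \<in> carrier (power_lmod R n)"
    then show "\<zero>\<^bsub>power_lmod R n\<^esub> \<oplus>\<^bsub>power_lmod R n\<^esub> v = v"
      using coord_closed[of v n] by (simp add: power_lmod_def)
  qed (auto simp: power_lmod_def)
  moreover have "left_module_axioms R (power_lmod R n)"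
  proof (rule left_module_axioms.intro)
    fix a v assume "a \<in> carrier R" "v \<in> carrier (power_lmod R n)"
    then show "a \<odot>\<^bsub>power_lmod R n\<^esub> v \<in> carrier (power_lmod R n)"
      by (simp add: power_lmod_def)
  next
    fix v assume v: "v \<in> carrier (power_lmod R n)"
    show "\<one> \<odot>\<^bsub>power_lmod R n\<^esub> v = v"
      using coord_closed[OF v] by (simp add: power_lmod_def)
  next
    fix a b v assume ab: "a \<in> carrier R" "b \<in> carrier R" and v: "v \<in> carrier (power_lmod R n)"
    show "(a \<oplus> b) \<odot>\<^bsub>power_lmod R n\<^esub> v = a \<odot>\<^bsub>power_lmod R n\<^esub> v \<oplus>\<^bsub>power_lmod R n\<^esub> b \<odot>\<^bsub>power_lmod R n\<^esub> v"
      "(a \<otimes> b) \<odot>\<^bsub>power_lmod R n\<^esub> v = a \<odot>\<^bsub>power_lmod R n\<^esub> (b \<odot>\<^bsub>power_lmod R n\<^esub> v)"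
      using ab coord_closed[OF v] by (simp_all add: power_lmod_def l_distr m_assoc)
  next
    fix a v w
    assume a: "a \<in> carrier R" and v: "v \<in> carrier (power_lmod R n)" and w: "w \<in> carrier (power_lmod R n)"
    show "a \<odot>\<^bsub>power_lmod R n\<^esub> (v \<oplus>\<^bsub>power_lmod R n\<^esub> w) = a \<odot>\<^bsub>power_lmod R n\<^esub> v \<oplus>\<^bsub>power_lmod R n\<^esub> a \<odot>\<^bsub>power_lmod R n\<^esub> w"
      using a coord_closed[OF v] coord_closed[OF w] by (simp add: power_lmod_def r_distr)
  qed
  ultimately show ?thesis
    by (intro left_module.intro ring_axioms)
qed

lemma coord_hom: "(\<lambda>v. v i) \<in> lmod_hom R (power_lmod R n) (regular_lmod R)"
proof (rule lmod_homI)
  show "v i \<in> carrier (regular_lmod R)" if "v \<in> carrier (power_lmod R n)" for v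
    using coord_closed[OF that] by (simp add: regular_lmod_def)
qed (simp_all add: regular_lmod_def power_lmod_def)

lemma std_vec_closed: "i < n \<Longrightarrow> std_vec R i \<in> carrier (power_lmod R n)"
  by (simp add: std_vec_def power_lmod_def)

lemma finsum_regular_lmod: "finsum (regular_lmod R) h I = finsum R h I"
  by (simp add: finsum_def finprod_def regular_lmod_def)

text \<open>Both sides are compared entry by entry: the \<open>j\<close>-th coordinate is linear,
  hence passes through the sum, where only the term \<open>i = j\<close> survives.\<close>

lemma finsum_std_vec:
  assumes "c \<in> {..<n} \<rightarrow> carrier R"
  shows "(\<Oplus>\<^bsub>power_lmod R n\<^esub>i\<in>{..<n}. c i \<odot>\<^bsub>power_lmod R n\<^esub> std_vec R i)
    = (\<lambda>j. if j < n then c j else \<zero>)"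
proof
  fix j
  interpret P: left_module R "power_lmod R n" by (rule power_left_module)
  interpret coord: left_module_hom R "power_lmod R n" "regular_lmod R" "\<lambda>v. v j"
    by (intro left_module_hom.intro left_module_hom_axioms.intro power_left_module
        regular_left_module coord_hom)
  have "(\<Oplus>\<^bsub>power_lmod R n\<^esub>i\<in>{..<n}. c i \<odot>\<^bsub>power_lmod R n\<^esub> std_vec R i) j
     = (\<Oplus>i\<in>{..<n}. (c i \<odot>\<^bsub>power_lmod R n\<^esub> std_vec R i) j)"
    using assms by (subst coord.hom_finsum)
      (auto simp: finsum_regular_lmod intro!: P.smult_closed std_vec_closed)
  also have "\<dots> = (\<Oplus>i\<in>{..<n}. if j = i then c i else \<zero>)"
    using assms by (intro finsum_cong') (auto simp: power_lmod_def std_vec_def Pi_def)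
  also have "\<dots> = (if j < n then c j else \<zero>)"
  proof (cases "j < n")
    case True
    then show ?thesis using assms finsum_singleton[of j "{..<n}" c] by simp
  next
    case False
    then have "(\<Oplus>i\<in>{..<n}. if j = i then c i else \<zero>) = (\<Oplus>i\<in>{..<n}. \<zero>)"
      by (intro finsum_cong') auto
    with False show ?thesis by simp
  qed
  finally show "(\<Oplus>\<^bsub>power_lmod R n\<^esub>i\<in>{..<n}. c i \<odot>\<^bsub>power_lmod R n\<^esub> std_vec R i) j
    = (if j < n then c j else \<zero>)" .
qed

lemma power_lmod_decomp:
  assumes "v \<in> carrier (power_lmod R n)"
  shows "(\<Oplus>\<^bsub>power_lmod R n\<^esub>i\<in>{..<n}. v i \<odot>\<^bsub>power_lmod R n\<^esub> std_vec R i) = v"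
proof -
  have "v \<in> {..<n} \<rightarrow> carrier R" using coord_closed[OF assms] by simp
  then show ?thesis
    using assms by (subst finsum_std_vec) (auto simp: power_lmod_def)
qed

end

section \<open>Linear maps out of \<open>R^n\<close>\<close>

context left_module
begin

lemma smult_finsum:
  assumes "a \<in> carrier R" "h \<in> I \<rightarrow> carrier M"
  shows "a \<odot>\<^bsub>M\<^esub> (\<Oplus>\<^bsub>M\<^esub>i\<in>I. h i) = (\<Oplus>\<^bsub>M\<^esub>i\<in>I. a \<odot>\<^bsub>M\<^esub> h i)"
  using assms(2)
proof (induction I rule: infinite_finite_induct)
  case (insert i I)
  then have "h \<in> I \<rightarrow> carrier M" "h i \<in> carrier M" "(\<lambda>i. a \<odot>\<^bsub>M\<^esub> h i) \<in> I \<rightarrow> carrier M"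
    using assms(1) smult_closed by auto
  with insert assms(1) show ?case by (simp add: smult_r_distr smult_closed)
qed (simp_all add: smult_r_null assms(1))

text \<open>Existence half of the universal property of \<open>R^n\<close>: the standard vectors may
  be sent to any \<open>n\<close> elements of \<open>M\<close>.\<close>

lemma lincomb_hom:
  assumes m: "m \<in> {..<n} \<rightarrow> carrier M"
  shows "(\<lambda>v. \<Oplus>\<^bsub>M\<^esub>i\<in>{..<n}. v i \<odot>\<^bsub>M\<^esub> m i) \<in> lmod_hom R (power_lmod R n) M"
proof (rule lmod_homI)
  have mi: "m i \<in> carrier M" if "i < n" for i using m that by auto
  fix v assume v: "v \<in> carrier (power_lmod R n)"
  note vi = R.coord_closed[OF v]
  have vm: "(\<lambda>i. v i \<odot>\<^bsub>M\<^esub> m i) \<in> {..<n} \<rightarrow> carrier M"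
    using mi vi by (simp add: smult_closed)
  then show "(\<Oplus>\<^bsub>M\<^esub>i\<in>{..<n}. v i \<odot>\<^bsub>M\<^esub> m i) \<in> carrier M" by simp
  fix w assume w: "w \<in> carrier (power_lmod R n)"
  note wi = R.coord_closed[OF w]
  have wm: "(\<lambda>i. w i \<odot>\<^bsub>M\<^esub> m i) \<in> {..<n} \<rightarrow> carrier M"
    using mi wi by (simp add: smult_closed)
  show "(\<Oplus>\<^bsub>M\<^esub>i\<in>{..<n}. (v \<oplus>\<^bsub>power_lmod R n\<^esub> w) i \<odot>\<^bsub>M\<^esub> m i)
    = (\<Oplus>\<^bsub>M\<^esub>i\<in>{..<n}. v i \<odot>\<^bsub>M\<^esub> m i) \<oplus>\<^bsub>M\<^esub> (\<Oplus>\<^bsub>M\<^esub>i\<in>{..<n}. w i \<odot>\<^bsub>M\<^esub> m i)"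
    unfolding M.finsum_addf[OF vm wm, symmetric] using mi vi wi
    by (intro M.finsum_cong') (simp_all add: power_lmod_def smult_l_distr smult_closed)
next
  have mi: "m i \<in> carrier M" if "i < n" for i using m that by auto
  fix a v assume a: "a \<in> carrier R" and v: "v \<in> carrier (power_lmod R n)"
  note vi = R.coord_closed[OF v]
  have vm: "(\<lambda>i. v i \<odot>\<^bsub>M\<^esub> m i) \<in> {..<n} \<rightarrow> carrier M"
    using mi vi by (simp add: smult_closed)
  show "(\<Oplus>\<^bsub>M\<^esub>i\<in>{..<n}. (a \<odot>\<^bsub>power_lmod R n\<^esub> v) i \<odot>\<^bsub>M\<^esub> m i)
    = a \<odot>\<^bsub>M\<^esub> (\<Oplus>\<^bsub>M\<^esub>i\<in>{..<n}. v i \<odot>\<^bsub>M\<^esub> m i)"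
    unfolding smult_finsum[OF a vm] using a mi vi
    by (intro M.finsum_cong') (simp_all add: power_lmod_def smult_assoc smult_closed)
qed

text \<open>Uniqueness half: a linear map on \<open>R^n\<close> is determined by its values on the
  standard vectors.\<close>

lemma hom_power_eq_lincomb:
  assumes f: "f \<in> lmod_hom R (power_lmod R n) M" and v: "v \<in> carrier (power_lmod R n)"
  shows "f v = (\<Oplus>\<^bsub>M\<^esub>i\<in>{..<n}. v i \<odot>\<^bsub>M\<^esub> f (std_vec R i))"
proof -
  interpret P: left_module R "power_lmod R n" by (rule R.power_left_module)
  interpret f: left_module_hom R "power_lmod R n" M f by unfold_locales (rule f)
  have vm: "(\<lambda>i. v i \<odot>\<^bsub>power_lmod R n\<^esub> std_vec R i) \<in> {..<n} \<rightarrow> carrier (power_lmod R n)"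
    using R.coord_closed[OF v] by (simp add: P.smult_closed R.std_vec_closed)
  have "f v = f (\<Oplus>\<^bsub>power_lmod R n\<^esub>i\<in>{..<n}. v i \<odot>\<^bsub>power_lmod R n\<^esub> std_vec R i)"
    using R.power_lmod_decomp[OF v] by simp
  also have "\<dots> = (\<Oplus>\<^bsub>M\<^esub>i\<in>{..<n}. v i \<odot>\<^bsub>M\<^esub> f (std_vec R i))"
    unfolding f.hom_finsum[OF vm] using R.coord_closed[OF v]
    by (intro M.finsum_cong')
      (simp_all add: f.hom_smult f.hom_closed R.std_vec_closed smult_closed)
  finally show ?thesis .
qed

lemma lincomb_std_vec:
  assumes m: "m \<in> {..<n} \<rightarrow> carrier M" and "j < n"
  shows "(\<Oplus>\<^bsub>M\<^esub>i\<in>{..<n}. std_vec R j i \<odot>\<^bsub>M\<^esub> m i) = m j"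
proof -
  have "(\<Oplus>\<^bsub>M\<^esub>i\<in>{..<n}. std_vec R j i \<odot>\<^bsub>M\<^esub> m i) = (\<Oplus>\<^bsub>M\<^esub>i\<in>{..<n}. if j = i then m i else \<zero>\<^bsub>M\<^esub>)"
    using m by (intro M.finsum_cong') (auto simp: std_vec_def smult_one smult_l_null Pi_def)
  also have "\<dots> = m j" using assms by (intro M.finsum_singleton) auto
  finally show ?thesis .
qed

text \<open>Sending the standard vectors to the finitely many generators gives a linear map whose
  image is a submodule containing all of them.\<close>

lemma fin_gen_power_cover:
  assumes "fin_gen_lmod R M"
  obtains n f where "f \<in> lmod_hom R (power_lmod R n) M" "f ` carrier (power_lmod R n) = carrier M"
proof -
  obtain A where A: "finite A" "A \<subseteq> carrier M" "carrier M = lmod_span R M A"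
    using assms by (auto simp: fin_gen_lmod_def)
  obtain n :: nat and m where m: "A = m ` {..<n}"
    using \<open>finite A\<close> finite_imp_nat_seg_image_inj_on[of A] by (auto simp: lessThan_def)
  have mM: "m \<in> {..<n} \<rightarrow> carrier M" using m A by auto
  let ?f = "\<lambda>v. \<Oplus>\<^bsub>M\<^esub>i\<in>{..<n}. v i \<odot>\<^bsub>M\<^esub> m i"
  interpret P: left_module R "power_lmod R n" by (rule R.power_left_module)
  interpret f: left_module_hom R "power_lmod R n" M ?f by unfold_locales (rule lincomb_hom[OF mM])
  have "A \<subseteq> ?f ` carrier (power_lmod R n)"
  proof
    fix x assume "x \<in> A"
    then obtain i where "i < n" "x = m i" using m by auto
    then show "x \<in> ?f ` carrier (power_lmod R n)"
      using lincomb_std_vec[OF mM] R.std_vec_closed by (intro image_eqI[of _ _ "std_vec R i"]) simp_all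
  qed
  then have "carrier M \<subseteq> ?f ` carrier (power_lmod R n)"
    unfolding A(3) by (intro span_minimal f.image_submodule P.carrier_submodule)
  then show ?thesis using that[OF f.hom] f.hom_closed by blast
qed

end

text \<open>\<open>R^n\<close> is projective: choose \<open>f\<close>-preimages of the values of
  \<open>h\<close> on the standard vectors and extend linearly.\<close>

lemma (in left_module_hom) power_lift:
  assumes h: "h \<in> lmod_hom R (power_lmod R n) N"
    and "h ` carrier (power_lmod R n) \<subseteq> f ` carrier M"
  obtains g where "g \<in> lmod_hom R (power_lmod R n) M"
    "\<And>v. v \<in> carrier (power_lmod R n) \<Longrightarrow> f (g v) = h v"
proof -
  define m where "m i = inv_into (carrier M) f (h (std_vec R i))" for i
  have "h (std_vec R i) \<in> f ` carrier M" if "i < n" for i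
    using assms(2) dom.R.std_vec_closed[OF that] by blast
  then have m: "m i \<in> carrier M" "f (m i) = h (std_vec R i)" if "i < n" for i
    using that by (simp_all add: m_def inv_into_into f_inv_into_f)
  let ?g = "\<lambda>v. \<Oplus>\<^bsub>M\<^esub>i\<in>{..<n}. v i \<odot>\<^bsub>M\<^esub> m i"
  have "f (?g v) = h v" if v: "v \<in> carrier (power_lmod R n)" for v
  proof -
    have "f (?g v) = (\<Oplus>\<^bsub>N\<^esub>i\<in>{..<n}. f (v i \<odot>\<^bsub>M\<^esub> m i))"
      using m dom.R.coord_closed[OF v] by (intro hom_finsum) (simp add: dom.smult_closed)
    also have "\<dots> = (\<Oplus>\<^bsub>N\<^esub>i\<in>{..<n}. v i \<odot>\<^bsub>N\<^esub> h (std_vec R i))"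
      using m dom.R.coord_closed[OF v]
      by (intro cod.M.finsum_cong') (simp_all add: hom_smult hom_closed cod.smult_closed flip: m(2))
    finally show ?thesis using cod.hom_power_eq_lincomb[OF h v] by simp
  qed
  then show ?thesis using that[of ?g] dom.lincomb_hom[of m n] m(1) by simp
qed

section \<open>Finitely presented modules\<close>

text \<open>Schanuel's lemma in weak form: if \<open>R\<^sup>n \<rightarrow> N\<close> has finitely generated kernel, lift it to
  \<open>\<phi> : R\<^sup>n \<rightarrow> M\<close> and let \<open>w\<^sub>a\<close> have the same image in \<open>N\<close> as the generator \<open>a\<close> of \<open>M\<close>.  Then the
  kernel of \<open>M \<rightarrow> N\<close> is generated by the image of the kernel under \<open>\<phi>\<close> and the \<open>a - \<phi> w\<^sub>a\<close>.\<close>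

lemma (in left_module_hom) fin_gen_kernel:
  assumes surj: "f ` carrier M = carrier N"
    and "fin_gen_lmod R M" "fin_pres_lmod R N"
  shows "fin_gen_lmod R (M\<lparr>carrier := lmod_kernel M N f\<rparr>)"
proof -
  obtain n h where h: "h \<in> lmod_hom R (power_lmod R n) N"
      "h ` carrier (power_lmod R n) = carrier N"
      "fin_gen_lmod R ((power_lmod R n)\<lparr>carrier := lmod_kernel (power_lmod R n) N h\<rparr>)"
    using assms(3) unfolding fin_pres_lmod_def by blast
  interpret P: left_module R "power_lmod R n" by (rule dom.R.power_left_module)
  interpret h: left_module_hom R "power_lmod R n" N h by unfold_locales (rule h)
  obtain \<phi> where \<phi>: "\<phi> \<in> lmod_hom R (power_lmod R n) M"
      "\<And>v. v \<in> carrier (power_lmod R n) \<Longrightarrow> f (\<phi> v) = h v"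
    using power_lift[OF h(1)] h(2) surj by blast
  interpret \<phi>: left_module_hom R "power_lmod R n" M \<phi> by unfold_locales (rule \<phi>)
  obtain A where A: "finite A" "A \<subseteq> carrier M" "carrier M = lmod_span R M A"
    using assms(2) by (auto simp: fin_gen_lmod_def)
  obtain B where B: "finite B" "B \<subseteq> carrier (power_lmod R n)"
      "lmod_kernel (power_lmod R n) N h = lmod_span R (power_lmod R n) B"
    using h(3) by (auto simp: P.fin_gen_submodule_iff h.kernel_submodule)
  have "\<exists>w\<in>carrier (power_lmod R n). h w = f a" if "a \<in> A" for a
    using that A(2) hom_closed h(2) by (metis imageE subsetD)
  then obtain w where w: "\<And>a. a \<in> A \<Longrightarrow> w a \<in> carrier (power_lmod R n)" "\<And>a. a \<in> A \<Longrightarrow> h (w a) = f a"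
    by metis
  define C where "C = (\<lambda>a. a \<ominus>\<^bsub>M\<^esub> \<phi> (w a)) ` A \<union> \<phi> ` B"
  let ?H = "lmod_span R M C"
  have "B \<subseteq> lmod_kernel (power_lmod R n) N h"
    unfolding B(3) by (rule P.span_superset)
  then have "\<phi> ` B \<subseteq> lmod_kernel M N f"
    using B(2) \<phi>(2) \<phi>.hom_closed by (auto simp: lmod_kernel_def subset_iff)
  moreover have "a \<ominus>\<^bsub>M\<^esub> \<phi> (w a) \<in> lmod_kernel M N f" if "a \<in> A" for a
    using that A(2) w[OF that] \<phi>(2) \<phi>.hom_closed
    by (subst eq_iff_diff_in_kernel[symmetric]) auto
  ultimately have C: "C \<subseteq> lmod_kernel M N f" unfolding C_def by blast
  then have CM: "C \<subseteq> carrier M" by (auto simp: lmod_kernel_def)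
  note H = dom.span_submodule[OF CM]
  \<comment> \<open>\<open>T\<close> is \<open>?H + \<phi>(R^n)\<close>. Read as the preimage of a
    submodule of \<open>M/?H\<close>, it is a submodule without computation; it contains
    \<open>A\<close>, hence is all of \<open>M\<close>.\<close>
  define T where "T = {x \<in> carrier M. \<exists>v\<in>carrier (power_lmod R n). x \<ominus>\<^bsub>M\<^esub> \<phi> v \<in> ?H}"
  have "submodule T R M"
  proof -
    interpret Q: left_module R "quot_lmod M ?H" using H by (rule dom.quot_left_module)
    interpret \<pi>: left_module_hom R M "quot_lmod M ?H" "\<lambda>x. ?H +>\<^bsub>M\<^esub> x"
      by unfold_locales (rule dom.quot_hom[OF H])
    let ?S = "(\<lambda>x. ?H +>\<^bsub>M\<^esub> x) ` \<phi> ` carrier (power_lmod R n)"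
    have "T = {x \<in> carrier M. ?H +>\<^bsub>M\<^esub> x \<in> ?S}"
      using \<phi>.hom_closed \<pi>.eq_iff_diff_in_kernel dom.quot_kernel[OF H]
      by (auto simp: T_def image_iff)
    moreover have "submodule ?S R (quot_lmod M ?H)"
      by (intro \<pi>.image_submodule \<phi>.image_submodule P.carrier_submodule)
    ultimately show ?thesis using \<pi>.vimage_submodule by simp
  qed
  moreover have "A \<subseteq> T"
  proof
    fix a assume a: "a \<in> A"
    then have "a \<ominus>\<^bsub>M\<^esub> \<phi> (w a) \<in> ?H" using dom.span_superset[of C] by (auto simp: C_def)
    with a A(2) w(1)[OF a] show "a \<in> T" unfolding T_def by blast
  qed
  ultimately have T: "carrier M \<subseteq> T" unfolding A(3) by (rule dom.span_minimal)
  \<comment> \<open>Write \<open>x\<close> as an element of \<open>?H\<close> plus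
    \<open>\<phi> v\<close>. Since \<open>f\<close> kills \<open>x\<close> and \<open>?H\<close>, it
    kills \<open>\<phi> v\<close>, so \<open>v\<close> lies in the kernel of \<open>h\<close> and
    \<open>\<phi> v\<close> is spanned by the image of \<open>B\<close>.\<close>
  have "lmod_kernel M N f \<subseteq> ?H"
  proof
    fix x assume x: "x \<in> lmod_kernel M N f"
    then have xM: "x \<in> carrier M" by (simp add: lmod_kernel_def)
    with T obtain v where v: "v \<in> carrier (power_lmod R n)" "x \<ominus>\<^bsub>M\<^esub> \<phi> v \<in> ?H"
      by (auto simp: T_def)
    have "?H \<subseteq> lmod_kernel M N f" using C kernel_submodule by (intro dom.span_minimal)
    then have "f x = f (\<phi> v)" using v xM \<phi>.hom_closed by (subst eq_iff_diff_in_kernel) auto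
    then have "v \<in> lmod_kernel (power_lmod R n) N h"
      using v \<phi>(2) x by (simp add: lmod_kernel_def)
    then have "\<phi> v \<in> lmod_span R M (\<phi> ` B)" using \<phi>.image_span[OF B(2)] B(3) by blast
    moreover have "lmod_span R M (\<phi> ` B) \<subseteq> ?H"
      using H dom.span_superset[of C] by (intro dom.span_minimal) (auto simp: C_def)
    ultimately have "(x \<ominus>\<^bsub>M\<^esub> \<phi> v) \<oplus>\<^bsub>M\<^esub> \<phi> v \<in> ?H"
      using dom.submoduleD(3)[OF H v(2)] by blast
    then show "x \<in> ?H"
      using xM \<phi>.hom_closed[OF v(1)] by (simp add: a_minus_def dom.M.a_assoc dom.M.l_neg)
  qed
  moreover have "?H \<subseteq> lmod_kernel M N f" using C kernel_submodule by (intro dom.span_minimal)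
  moreover have "finite C" using A B by (simp add: C_def)
  ultimately show ?thesis
    using CM unfolding dom.fin_gen_submodule_iff[OF kernel_submodule] by blast
qed

lemma (in ring) fin_gen_power: "fin_gen_lmod R (power_lmod R n)"
proof -
  interpret P: left_module R "power_lmod R n" by (rule power_left_module)
  let ?A = "std_vec R ` {..<n}"
  have A: "?A \<subseteq> carrier (power_lmod R n)" using std_vec_closed by auto
  note S = P.span_submodule[OF A]
  have "v \<in> lmod_span R (power_lmod R n) ?A" if v: "v \<in> carrier (power_lmod R n)" for v
  proof -
    let ?g = "\<lambda>i. v i \<odot>\<^bsub>power_lmod R n\<^esub> std_vec R i"
    have g: "?g i \<in> lmod_span R (power_lmod R n) ?A" if "i < n" for i
      using that P.span_superset[of ?A] coord_closed[OF v] by (intro P.submoduleD(4)[OF S]) auto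
    have "(\<Oplus>\<^bsub>power_lmod R n\<^esub>i\<in>I. ?g i) \<in> lmod_span R (power_lmod R n) ?A"
      if "finite I" "I \<subseteq> {..<n}" for I
      using that
    proof (induction I rule: finite_induct)
      case (insert i I)
      then have "?g \<in> insert i I \<rightarrow> carrier (power_lmod R n)"
        using g P.submoduleD(1)[OF S] by blast
      with insert g P.submoduleD(3)[OF S] show ?case by simp
    qed (simp add: P.submoduleD(2)[OF S])
    from this[of "{..<n}"] show ?thesis using power_lmod_decomp[OF v] by simp
  qed
  then show ?thesis
    unfolding fin_gen_lmod_def using A P.submoduleD(1)[OF S] by (intro exI[of _ ?A]) auto
qed

lemma (in left_module) fin_pres_imp_fin_gen:
  assumes "fin_pres_lmod R M" shows "fin_gen_lmod R M"
proof -
  obtain n f where f: "f \<in> lmod_hom R (power_lmod R n) M"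
      "f ` carrier (power_lmod R n) = carrier M"
    using assms unfolding fin_pres_lmod_def by blast
  interpret P: left_module R "power_lmod R n" by (rule R.power_left_module)
  interpret f: left_module_hom R "power_lmod R n" M f by unfold_locales (rule f)
  show ?thesis using R.fin_gen_power f(2) by (rule f.fin_gen_image)
qed

section \<open>Submodules of \<open>R^n\<close> over noetherian rings and kernels over coherent
  rings\<close>

context ring
begin

lemma cyclic_regular: "cyclic_lmod R (regular_lmod R)"
proof -
  interpret L: left_module R "regular_lmod R" by (rule regular_left_module)
  have "lmod_span R (regular_lmod R) {\<one>} = (\<lambda>a. a \<otimes> \<one>) ` carrier R"
    using L.span_singleton[of \<one>] by (simp add: regular_lmod_def)
  then have "lmod_span R (regular_lmod R) {\<one>} = carrier R" by simp
  then show ?thesis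
    by (auto simp: cyclic_lmod_def regular_lmod_def intro!: bexI[of _ \<one>])
qed

text \<open>The submodule \<open>K\<close> is filtered by its vectors supported on the first \<open>j\<close> coordinates; the
  \<open>j\<close>-th coordinate embeds each successive quotient in \<open>R\<close>.\<close>

lemma left_noetherian_power:
  assumes "left_noetherian R" and K: "submodule K R (power_lmod R n)"
  shows "fin_gen_lmod R ((power_lmod R n)\<lparr>carrier := K\<rparr>)"
proof -
  interpret P: left_module R "power_lmod R n" by (rule power_left_module)
  define F where "F j = {v \<in> K. \<forall>i\<ge>j. v i = \<zero>}" for j
  have F: "submodule (F j) R (power_lmod R n)" for j
  proof (rule P.submoduleI)
    show "F j \<subseteq> carrier (power_lmod R n)" using P.submoduleD(1)[OF K] by (auto simp: F_def)
    show "\<zero>\<^bsub>power_lmod R n\<^esub> \<in> F j"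
      using P.submoduleD(2)[OF K] by (simp add: F_def power_lmod_def)
    show "v \<oplus>\<^bsub>power_lmod R n\<^esub> w \<in> F j" if "v \<in> F j" "w \<in> F j" for v w
      using P.submoduleD(3)[OF K, of v w] that by (simp add: F_def power_lmod_def)
    show "a \<odot>\<^bsub>power_lmod R n\<^esub> v \<in> F j" if "a \<in> carrier R" "v \<in> F j" for a v
      using P.submoduleD(4)[OF K, of a v] that by (simp add: F_def power_lmod_def)
  qed
  have "fin_gen_lmod R ((power_lmod R n)\<lparr>carrier := F j\<rparr>)" for j
  proof (induction j)
    case 0
    have "F 0 = {\<zero>\<^bsub>power_lmod R n\<^esub>}"
      using P.submoduleD(2)[OF K] by (auto simp: F_def power_lmod_def)
    moreover have "lmod_span R (power_lmod R n) {\<zero>\<^bsub>power_lmod R n\<^esub>} = {\<zero>\<^bsub>power_lmod R n\<^esub>}"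
      using P.span_superset P.span_minimal[OF P.zero_submodule] by blast
    ultimately show ?case
      unfolding P.fin_gen_submodule_iff[OF F]
      by (intro exI[of _ "{\<zero>\<^bsub>power_lmod R n\<^esub>}"]) simp
  next
    case (Suc j)
    interpret coord: left_module_hom R "power_lmod R n" "regular_lmod R" "\<lambda>v. v j"
      by (intro left_module_hom.intro left_module_hom_axioms.intro power_left_module
          regular_left_module coord_hom)
    have "left_ideal ((\<lambda>v. v j) ` F (Suc j)) R"
      unfolding left_ideal_def using F by (rule coord.image_submodule)
    then have "fin_gen_lmod R ((regular_lmod R)\<lparr>carrier := (\<lambda>v. v j) ` F (Suc j)\<rparr>)"
      using assms(1) by (simp add: left_noetherian_def)
    \<comment> \<open>Vectors in \<open>F (Suc j)\<close> may be non-zero up to position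
      \<open>j\<close> inclusive, so the kernel of the \<open>j\<close>-th coordinate on them is
      exactly \<open>F j\<close>.\<close>
    moreover have "(\<forall>i\<ge>j. v i = \<zero>) \<longleftrightarrow> v j = \<zero> \<and> (\<forall>i\<ge>Suc j. v i = \<zero>)" for v
      by (metis Suc_leD le_antisym not_less_eq_eq order_refl)
    then have "F (Suc j) \<inter> lmod_kernel (power_lmod R n) (regular_lmod R) (\<lambda>v. v j) = F j"
      using P.submoduleD(1)[OF K] by (auto simp: F_def lmod_kernel_def regular_lmod_def)
    ultimately show ?case
      using coord.fin_gen_submodule_extension[OF F] Suc by simp
  qed
  \<comment> \<open>Entries from \<open>n\<close> on vanish in \<open>power_lmod R n\<close>, so the
    filtration is exhausted at \<open>n\<close>.\<close>
  moreover have "F n = K" using P.submoduleD(1)[OF K] by (auto simp: F_def power_lmod_def)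
  ultimately show ?thesis by metis
qed

text \<open>Start from \<open>K 0 = R\<close>, generated by one. If \<open>K j\<close> is finitely
  generated, its \<open>j\<close>-th coordinate image is a finitely generated left ideal, finitely
  presented by coherence, so \<open>fin_gen_kernel\<close> handles the next kernel
  \<open>K (Suc j)\<close>.\<close>

lemma left_coherent_kernel:
  assumes "left_coherent R" and g: "g \<in> lmod_hom R (regular_lmod R) (power_lmod R k)"
  shows "fin_gen_lmod R ((regular_lmod R)\<lparr>carrier := lmod_kernel (regular_lmod R) (power_lmod R k) g\<rparr>)"
proof -
  interpret L: left_module R "regular_lmod R" by (rule regular_left_module)
  interpret P: left_module R "power_lmod R k" by (rule power_left_module)
  interpret g: left_module_hom R "regular_lmod R" "power_lmod R k" g by unfold_locales (rule g)
  define K where "K j = {r \<in> carrier R. \<forall>i<j. g r i = \<zero>}" for j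
  have gj: "(\<lambda>r. g r j) \<in> lmod_hom R (regular_lmod R) (regular_lmod R)" for j
    using lmod_hom_comp[OF g coord_hom] by (simp add: comp_def)
  interpret gj: left_module_hom R "regular_lmod R" "regular_lmod R" "\<lambda>r. g r j" for j
    by unfold_locales (rule gj)
  have KSuc: "K (Suc j) = K j \<inter> lmod_kernel (regular_lmod R) (regular_lmod R) (\<lambda>r. g r j)" for j
    by (auto simp: K_def lmod_kernel_def regular_lmod_def less_Suc_eq)
  have K: "submodule (K j) R (regular_lmod R)" for j
  proof (induction j)
    case 0
    then show ?case using L.carrier_submodule by (simp add: K_def regular_lmod_def)
  next
    case (Suc j)
    then show ?case unfolding KSuc by (intro L.submodule_Int gj.kernel_submodule)
  qed
  have "fin_gen_lmod R ((regular_lmod R)\<lparr>carrier := K j\<rparr>)" for j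
  proof (induction j)
    case 0
    have "K 0 = carrier (regular_lmod R)" by (simp add: K_def regular_lmod_def)
    then show ?case using L.cyclic_imp_fin_gen[OF cyclic_regular] by simp
  next
    case (Suc j)
    let ?I = "(\<lambda>r. g r j) ` K j"
    have I: "submodule ?I R (regular_lmod R)" using K by (rule gj.image_submodule)
    \<comment> \<open>Domain and codomain are both restricted so that the coordinate map is onto the
      ideal \<open>?I\<close>, as \<open>fin_gen_kernel\<close> demands.\<close>
    interpret r: left_module_hom R "(regular_lmod R)\<lparr>carrier := K j\<rparr>"
      "(regular_lmod R)\<lparr>carrier := ?I\<rparr>" "\<lambda>r. g r j"
    proof (intro left_module_hom.intro left_module_hom_axioms.intro)
      show "(\<lambda>r. g r j) \<in> lmod_hom R ((regular_lmod R)\<lparr>carrier := K j\<rparr>) ((regular_lmod R)\<lparr>carrier := ?I\<rparr>)"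
        using subsetD[OF L.submoduleD(1)[OF K[of j]]]
        by (intro lmod_homI) (simp_all add: gj.hom_add gj.hom_smult)
    qed (use K I in \<open>simp_all add: L.submodule_left_module\<close>)
    have "fin_gen_lmod R ((regular_lmod R)\<lparr>carrier := ?I\<rparr>)"
      using Suc by (rule r.fin_gen_image) simp
    then have "fin_pres_lmod R ((regular_lmod R)\<lparr>carrier := ?I\<rparr>)"
      using assms(1) I by (simp add: left_coherent_def left_ideal_def)
    then have "fin_gen_lmod R ((regular_lmod R)\<lparr>carrier := K j\<rparr>
      \<lparr>carrier := lmod_kernel ((regular_lmod R)\<lparr>carrier := K j\<rparr>) ((regular_lmod R)\<lparr>carrier := ?I\<rparr>) (\<lambda>r. g r j)\<rparr>)"
      using Suc by (intro r.fin_gen_kernel) simp_all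
    moreover have "lmod_kernel ((regular_lmod R)\<lparr>carrier := K j\<rparr>) ((regular_lmod R)\<lparr>carrier := ?I\<rparr>) (\<lambda>r. g r j)
      = K (Suc j)"
      unfolding KSuc using L.submoduleD(1)[OF K] by (auto simp: lmod_kernel_def)
    ultimately show ?case by simp
  qed
  moreover have "K k = lmod_kernel (regular_lmod R) (power_lmod R k) g"
  proof -
    \<comment> \<open>Vanishing of the first \<open>k\<close> entries suffices, the remaining ones
      being zero in \<open>power_lmod R k\<close> anyway.\<close>
    have "g r = (\<lambda>i. \<zero>) \<longleftrightarrow> (\<forall>i<k. g r i = \<zero>)" if "r \<in> carrier R" for r
      using g.hom_closed[of r] that by (auto simp: power_lmod_def regular_lmod_def fun_eq_iff) (metis not_le)
    then show ?thesis by (auto simp: K_def lmod_kernel_def power_lmod_def regular_lmod_def)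
  qed
  ultimately show ?thesis by metis
qed

end

section \<open>Free modules\<close>

text \<open>Supplies the free modules on \<open>nat \<Rightarrow> 'a\<close> that receive the
  embeddings in the conclusions.\<close>

lemma (in ring) power_lmod_free: "free_lmod R (power_lmod R n)"
proof -
  interpret P: left_module R "power_lmod R n" by (rule power_left_module)
  \<comment> \<open>Over the zero ring the standard vectors all coincide.\<close>
  let ?B = "if \<one> = \<zero> then {} else std_vec R ` {..<n}"
  have "lmod_basis R (power_lmod R n) ?B"
    unfolding lmod_basis_def
  proof (intro conjI ballI)
    show "?B \<subseteq> carrier (power_lmod R n)" using std_vec_closed by auto
    fix v assume v: "v \<in> carrier (power_lmod R n)"
    let ?Q = "\<lambda>c. c \<in> ?B \<rightarrow> carrier R \<and> (\<forall>b. b \<notin> ?B \<longrightarrow> c b = \<zero>) \<and> finite {b. c b \<noteq> \<zero>} \<and>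
      v = (\<Oplus>\<^bsub>power_lmod R n\<^esub>b\<in>{b. c b \<noteq> \<zero>}. c b \<odot>\<^bsub>power_lmod R n\<^esub> b)"
    show "\<exists>!c. ?Q c"
    proof (cases "\<one> = \<zero>")
      case True
      then have "v i = \<zero>" for i using coord_closed[OF v, of i] by (metis l_null l_one)
      then have "v = \<zero>\<^bsub>power_lmod R n\<^esub>" by (auto simp: power_lmod_def)
      with True show ?thesis by (intro ex1I[of _ "\<lambda>_. \<zero>"]) auto
    next
      case False
      have inj: "inj_on (std_vec R) {..<n}"
        using False by (auto simp: inj_on_def std_vec_def fun_eq_iff)
      \<comment> \<open>A coefficient function sums to the vector of its values at the standard
        vectors, so existence and uniqueness of coefficients both become reading off
        entries.\<close>
      have sum: "(\<Oplus>\<^bsub>power_lmod R n\<^esub>b\<in>{b. c b \<noteq> \<zero>}. c b \<odot>\<^bsub>power_lmod R n\<^esub> b)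
          = (\<lambda>j. if j < n then c (std_vec R j) else \<zero>)"
        if c: "c \<in> std_vec R ` {..<n} \<rightarrow> carrier R" "\<forall>b. b \<notin> std_vec R ` {..<n} \<longrightarrow> c b = \<zero>" for c
      proof -
        have cl: "c b \<odot>\<^bsub>power_lmod R n\<^esub> b \<in> carrier (power_lmod R n)" if "b \<in> std_vec R ` {..<n}" for b
          using that c(1) std_vec_closed by (intro P.smult_closed) auto
        have "(\<Oplus>\<^bsub>power_lmod R n\<^esub>b\<in>{b. c b \<noteq> \<zero>}. c b \<odot>\<^bsub>power_lmod R n\<^esub> b)
          = (\<Oplus>\<^bsub>power_lmod R n\<^esub>b\<in>std_vec R ` {..<n}. c b \<odot>\<^bsub>power_lmod R n\<^esub> b)"
          using c cl std_vec_closed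
          by (intro P.M.add.finprod_mono_neutral_cong_left) (auto intro!: P.smult_l_null)
        also have "\<dots> = (\<Oplus>\<^bsub>power_lmod R n\<^esub>i\<in>{..<n}. c (std_vec R i) \<odot>\<^bsub>power_lmod R n\<^esub> std_vec R i)"
          using cl inj by (intro P.M.finsum_reindex) auto
        also have "\<dots> = (\<lambda>j. if j < n then c (std_vec R j) else \<zero>)"
          using c by (intro finsum_std_vec) auto
        finally show ?thesis .
      qed
      \<comment> \<open>Injectivity lets \<open>inv_into\<close> recover the index of a basis
        vector, whose coefficient is the entry of \<open>v\<close> there.\<close>
      let ?c = "\<lambda>b. if b \<in> std_vec R ` {..<n} then v (inv_into {..<n} (std_vec R) b) else \<zero>"
      show ?thesis
      proof (rule ex1I[of _ ?c])
        have "{b. ?c b \<noteq> \<zero>} \<subseteq> std_vec R ` {..<n}" by auto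
        then have "finite {b. ?c b \<noteq> \<zero>}" by (rule finite_subset) simp
        moreover have c: "?c \<in> std_vec R ` {..<n} \<rightarrow> carrier R" using coord_closed[OF v] by auto
        moreover have "(\<lambda>j. if j < n then ?c (std_vec R j) else \<zero>) = v"
          using inj v by (auto simp: power_lmod_def)
        ultimately show "?Q ?c" using False by (simp add: sum[OF c])
      next
        fix d assume d: "?Q d"
        then have d': "d \<in> std_vec R ` {..<n} \<rightarrow> carrier R" "\<forall>b. b \<notin> std_vec R ` {..<n} \<longrightarrow> d b = \<zero>"
          using False by auto
        have "v = (\<lambda>j. if j < n then d (std_vec R j) else \<zero>)"
          using d sum[OF d'] by simp
        then have "v j = d (std_vec R j)" if "j < n" for j using that by simp
        then show "d = ?c" using d' inj by (auto simp: fun_eq_iff)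
      qed
    qed
  qed
  then show ?thesis unfolding free_lmod_def using power_left_module by blast
qed

text \<open>Coordinates with respect to a basis are linear because sums and multiples of expansions
  are again expansions, and expansions are unique. Besides the module axioms, these three properties
  are all that is later used of freeness.\<close>

lemma free_lmod_coordinates:
  fixes F :: "('a, 'f, 's) module_scheme"
  assumes "free_lmod R F"
  obtains c :: "'f \<Rightarrow> 'f \<Rightarrow> 'a" where "\<And>b. (\<lambda>x. c x b) \<in> lmod_hom R F (regular_lmod R)"
    "\<And>x. x \<in> carrier F \<Longrightarrow> finite {b. c x b \<noteq> \<zero>\<^bsub>R\<^esub>}"
    "\<And>x. \<lbrakk>x \<in> carrier F; \<And>b. c x b = \<zero>\<^bsub>R\<^esub>\<rbrakk> \<Longrightarrow> x = \<zero>\<^bsub>F\<^esub>"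
proof -
  interpret F: left_module R F using assms by (simp add: free_lmod_def)
  obtain B where B: "lmod_basis R F B" using assms by (auto simp: free_lmod_def)
  then have BF: "B \<subseteq> carrier F" by (simp add: lmod_basis_def)
  define Q where "Q x c \<longleftrightarrow> c \<in> B \<rightarrow> carrier R \<and> (\<forall>b. b \<notin> B \<longrightarrow> c b = \<zero>\<^bsub>R\<^esub>) \<and>
      finite {b. c b \<noteq> \<zero>\<^bsub>R\<^esub>} \<and> x = (\<Oplus>\<^bsub>F\<^esub>b\<in>{b. c b \<noteq> \<zero>\<^bsub>R\<^esub>}. c b \<odot>\<^bsub>F\<^esub> b)" for x c
  have Q1: "\<exists>!c. Q x c" if "x \<in> carrier F" for x
    using B that unfolding lmod_basis_def Q_def by blast
  define c where "c x = (THE c. Q x c)" for x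
  have c: "Q x (c x)" if "x \<in> carrier F" for x
    using theI'[OF Q1[OF that]] by (simp add: c_def)
  have c_eq: "c x = d" if "Q x d" "x \<in> carrier F" for x d
    using Q1[OF that(2)] c[OF that(2)] that(1) by blast
  have QR: "d b \<in> carrier R" if "Q x d" for x d b
    using that by (cases "b \<in> B") (auto simp: Q_def)
  have QB: "{b. d b \<noteq> \<zero>\<^bsub>R\<^esub>} \<subseteq> B" if "Q x d" for x d
    using that by (auto simp: Q_def)
  have term_closed: "d b \<odot>\<^bsub>F\<^esub> b \<in> carrier F" if "Q x d" "b \<in> B" for x d b
    using QR[OF that(1)] that(2) BF by (auto intro: F.smult_closed)
  \<comment> \<open>Expansions of different elements have different supports; padding with zero
    terms brings them onto a common finite set.\<close>
  have sum_ext: "(\<Oplus>\<^bsub>F\<^esub>b\<in>{b. d b \<noteq> \<zero>\<^bsub>R\<^esub>}. d b \<odot>\<^bsub>F\<^esub> b) = (\<Oplus>\<^bsub>F\<^esub>b\<in>S. d b \<odot>\<^bsub>F\<^esub> b)"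
    if "finite S" "{b. d b \<noteq> \<zero>\<^bsub>R\<^esub>} \<subseteq> S" "S \<subseteq> B" "\<And>b. d b \<in> carrier R" for d S
    using that BF
    by (intro F.M.add.finprod_mono_neutral_cong_left)
      (auto simp: subset_iff intro!: F.smult_l_null F.smult_closed)
  have add: "Q (x \<oplus>\<^bsub>F\<^esub> y) (\<lambda>b. d b \<oplus>\<^bsub>R\<^esub> e b)" if d: "Q x d" and e: "Q y e" for x y d e
  proof -
    let ?S = "{b. d b \<noteq> \<zero>\<^bsub>R\<^esub>} \<union> {b. e b \<noteq> \<zero>\<^bsub>R\<^esub>}"
    have S: "finite ?S" "?S \<subseteq> B" using d e by (auto simp: Q_def)
    have sub: "{b. d b \<oplus>\<^bsub>R\<^esub> e b \<noteq> \<zero>\<^bsub>R\<^esub>} \<subseteq> ?S" by auto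
    have "x = (\<Oplus>\<^bsub>F\<^esub>b\<in>?S. d b \<odot>\<^bsub>F\<^esub> b)"
      using d S QR[OF d] by (subst sum_ext[symmetric]) (auto simp: Q_def)
    moreover have "y = (\<Oplus>\<^bsub>F\<^esub>b\<in>?S. e b \<odot>\<^bsub>F\<^esub> b)"
      using e S QR[OF e] by (subst sum_ext[symmetric]) (auto simp: Q_def)
    moreover have "(\<Oplus>\<^bsub>F\<^esub>b\<in>?S. d b \<odot>\<^bsub>F\<^esub> b) \<oplus>\<^bsub>F\<^esub> (\<Oplus>\<^bsub>F\<^esub>b\<in>?S. e b \<odot>\<^bsub>F\<^esub> b)
      = (\<Oplus>\<^bsub>F\<^esub>b\<in>?S. d b \<odot>\<^bsub>F\<^esub> b \<oplus>\<^bsub>F\<^esub> e b \<odot>\<^bsub>F\<^esub> b)"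
      using S(2) term_closed[OF d] term_closed[OF e]
      by (intro F.M.finsum_addf[symmetric]) blast+
    moreover have "\<dots> = (\<Oplus>\<^bsub>F\<^esub>b\<in>?S. (d b \<oplus>\<^bsub>R\<^esub> e b) \<odot>\<^bsub>F\<^esub> b)"
      using S(2) BF QR[OF d] QR[OF e]
      by (intro F.M.finsum_cong') (auto simp: F.smult_l_distr subset_iff intro!: F.smult_closed)
    moreover have "\<dots> = (\<Oplus>\<^bsub>F\<^esub>b\<in>{b. d b \<oplus>\<^bsub>R\<^esub> e b \<noteq> \<zero>\<^bsub>R\<^esub>}. (d b \<oplus>\<^bsub>R\<^esub> e b) \<odot>\<^bsub>F\<^esub> b)"
      using QR[OF d] QR[OF e] by (intro sum_ext[symmetric] S sub) simp
    moreover have "finite {b. d b \<oplus>\<^bsub>R\<^esub> e b \<noteq> \<zero>\<^bsub>R\<^esub>}" using S(1) sub by (rule rev_finite_subset)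
    ultimately show ?thesis using d e QR[OF d] QR[OF e] by (simp add: Q_def)
  qed
  have smult: "Q (a \<odot>\<^bsub>F\<^esub> x) (\<lambda>b. a \<otimes>\<^bsub>R\<^esub> d b)" if d: "Q x d" and a: "a \<in> carrier R" for x a d
  proof -
    let ?S = "{b. d b \<noteq> \<zero>\<^bsub>R\<^esub>}"
    have S: "finite ?S" "?S \<subseteq> B" using d by (auto simp: Q_def)
    \<comment> \<open>With zero divisors the support may shrink, so only an inclusion is available,
      which is what \<open>sum_ext\<close> asks for.\<close>
    have sub: "{b. a \<otimes>\<^bsub>R\<^esub> d b \<noteq> \<zero>\<^bsub>R\<^esub>} \<subseteq> ?S" using a by auto
    have "a \<odot>\<^bsub>F\<^esub> x = a \<odot>\<^bsub>F\<^esub> (\<Oplus>\<^bsub>F\<^esub>b\<in>?S. d b \<odot>\<^bsub>F\<^esub> b)" using d by (simp add: Q_def)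
    also have "\<dots> = (\<Oplus>\<^bsub>F\<^esub>b\<in>?S. a \<odot>\<^bsub>F\<^esub> (d b \<odot>\<^bsub>F\<^esub> b))"
      using S(2) term_closed[OF d] a by (intro F.smult_finsum) blast+
    also have "\<dots> = (\<Oplus>\<^bsub>F\<^esub>b\<in>?S. (a \<otimes>\<^bsub>R\<^esub> d b) \<odot>\<^bsub>F\<^esub> b)"
      using S(2) BF QR[OF d] a
      by (intro F.M.finsum_cong') (auto simp: F.smult_assoc subset_iff intro!: F.smult_closed)
    also have "\<dots> = (\<Oplus>\<^bsub>F\<^esub>b\<in>{b. a \<otimes>\<^bsub>R\<^esub> d b \<noteq> \<zero>\<^bsub>R\<^esub>}. (a \<otimes>\<^bsub>R\<^esub> d b) \<odot>\<^bsub>F\<^esub> b)"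
      using QR[OF d] a by (intro sum_ext[symmetric] S sub) simp
    finally have "a \<odot>\<^bsub>F\<^esub> x = \<dots>" .
    moreover have "finite {b. a \<otimes>\<^bsub>R\<^esub> d b \<noteq> \<zero>\<^bsub>R\<^esub>}" using S(1) sub by (rule rev_finite_subset)
    ultimately show ?thesis using d a QR[OF d] by (simp add: Q_def)
  qed
  show ?thesis
  proof
    show "(\<lambda>x. c x b) \<in> lmod_hom R F (regular_lmod R)" for b
    proof (rule lmod_homI)
      fix x assume x: "x \<in> carrier F"
      show "c x b \<in> carrier (regular_lmod R)" using QR[OF c[OF x]] by (simp add: regular_lmod_def)
      show "c (x \<oplus>\<^bsub>F\<^esub> y) b = c x b \<oplus>\<^bsub>regular_lmod R\<^esub> c y b" if y: "y \<in> carrier F" for y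
        using c_eq[OF add[OF c[OF x] c[OF y]]] x y by (simp add: regular_lmod_def)
    next
      fix a x assume "a \<in> carrier R" and x: "x \<in> carrier F"
      then show "c (a \<odot>\<^bsub>F\<^esub> x) b = a \<odot>\<^bsub>regular_lmod R\<^esub> c x b"
        using c_eq[OF smult[OF c[OF x]]] by (simp add: regular_lmod_def F.smult_closed)
    qed
    show "finite {b. c x b \<noteq> \<zero>\<^bsub>R\<^esub>}" if "x \<in> carrier F" for x
      using c[OF that] by (simp add: Q_def)
    show "x = \<zero>\<^bsub>F\<^esub>" if "x \<in> carrier F" "\<And>b. c x b = \<zero>\<^bsub>R\<^esub>" for x
      using c[OF that(1)] that(2) by (simp add: Q_def)
  qed
qed

context left_module
begin

lemma inj_hom_iff:
  assumes "left_module R N" "f \<in> lmod_hom R M N"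
  shows "inj_on f (carrier M) \<longleftrightarrow> (\<forall>x\<in>carrier M. f x = \<zero>\<^bsub>N\<^esub> \<longrightarrow> x = \<zero>\<^bsub>M\<^esub>)"
proof -
  interpret N: left_module R N by fact
  interpret f: left_module_hom R M N f by unfold_locales fact
  show ?thesis
  proof
    assume "inj_on f (carrier M)"
    then show "\<forall>x\<in>carrier M. f x = \<zero>\<^bsub>N\<^esub> \<longrightarrow> x = \<zero>\<^bsub>M\<^esub>"
      using f.hom_zero inj_onD[of f "carrier M" _ "\<zero>\<^bsub>M\<^esub>"] by simp
  next
    assume *: "\<forall>x\<in>carrier M. f x = \<zero>\<^bsub>N\<^esub> \<longrightarrow> x = \<zero>\<^bsub>M\<^esub>"
    show "inj_on f (carrier M)"
    proof (rule inj_onI)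
      fix x y assume "x \<in> carrier M" "y \<in> carrier M" "f x = f y"
      then show "x = y"
        using * f.eq_iff_diff_in_kernel[of x y] minus_eq_zero_iff[of x y]
        by (simp add: lmod_kernel_def)
    qed
  qed
qed

text \<open>The generators of \<open>M\<close> involve only finitely many basis elements.\<close>

lemma embeds_in_power:
  assumes "fin_gen_lmod R M" "embeds_in_free TYPE('f) R M"
  obtains k g where "g \<in> lmod_hom R M (power_lmod R k)" "inj_on g (carrier M)"
proof -
  obtain F :: "('a, 'f) module" and f where F: "free_lmod R F"
    and f: "f \<in> lmod_hom R M F" "inj_on f (carrier M)"
    using assms(2) unfolding embeds_in_free_def by blast
  obtain c :: "'f \<Rightarrow> 'f \<Rightarrow> 'a" where c: "\<And>b. (\<lambda>x. c x b) \<in> lmod_hom R F (regular_lmod R)"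
    "\<And>x. x \<in> carrier F \<Longrightarrow> finite {b. c x b \<noteq> \<zero>\<^bsub>R\<^esub>}"
    "\<And>x. \<lbrakk>x \<in> carrier F; \<And>b. c x b = \<zero>\<^bsub>R\<^esub>\<rbrakk> \<Longrightarrow> x = \<zero>\<^bsub>F\<^esub>"
    by (rule free_lmod_coordinates[OF F]) blast
  interpret F: left_module R F using F by (simp add: free_lmod_def)
  interpret f: left_module_hom R M F f by unfold_locales (rule f)
  have cf: "(\<lambda>x. c (f x) b) \<in> lmod_hom R M (regular_lmod R)" for b
    using lmod_hom_comp[OF f(1) c(1)] by (simp add: comp_def)
  interpret cf: left_module_hom R M "regular_lmod R" "\<lambda>x. c (f x) b" for b
    by (intro left_module_hom.intro left_module_hom_axioms.intro left_module_axioms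
        R.regular_left_module cf)
  obtain A where A: "finite A" "A \<subseteq> carrier M" "carrier M = lmod_span R M A"
    using assms(1) by (auto simp: fin_gen_lmod_def)
  define S where "S = (\<Union>a\<in>A. {b. c (f a) b \<noteq> \<zero>\<^bsub>R\<^esub>})"
  have "finite S" using A c(2) f.hom_closed by (auto simp: S_def)
  then obtain k :: nat and s where s: "S = s ` {..<k}"
    using finite_imp_nat_seg_image_inj_on[of S] by (auto simp: lessThan_def)
  \<comment> \<open>A coordinate outside \<open>S\<close> kills the generators, and its kernel is a
    submodule, so it kills all of \<open>M\<close>.\<close>
  have supp: "c (f x) b = \<zero>\<^bsub>R\<^esub>" if "x \<in> carrier M" "b \<notin> S" for x b
  proof -
    have "A \<subseteq> lmod_kernel M (regular_lmod R) (\<lambda>x. c (f x) b)"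
      using that(2) A(2) by (auto simp: S_def lmod_kernel_def regular_lmod_def)
    then have "carrier M \<subseteq> lmod_kernel M (regular_lmod R) (\<lambda>x. c (f x) b)"
      unfolding A(3) by (intro span_minimal cf.kernel_submodule)
    with that(1) show ?thesis by (auto simp: lmod_kernel_def regular_lmod_def)
  qed
  \<comment> \<open>Only the coordinates listed by \<open>s\<close> are kept, padded with zeros from
    \<open>k\<close> on to land in \<open>power_lmod R k\<close>.\<close>
  define g where "g x = (\<lambda>i. if i < k then c (f x) (s i) else \<zero>\<^bsub>R\<^esub>)" for x
  have g: "g \<in> lmod_hom R M (power_lmod R k)"
    using cf.hom_closed cf.hom_add cf.hom_smult
    by (intro lmod_homI) (auto simp: g_def power_lmod_def regular_lmod_def fun_eq_iff)
  have "x = \<zero>\<^bsub>M\<^esub>" if x: "x \<in> carrier M" "g x = \<zero>\<^bsub>power_lmod R k\<^esub>" for x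
  proof -
    have "c (f x) (s i) = \<zero>\<^bsub>R\<^esub>" if "i < k" for i
      using fun_cong[OF x(2), of i] that by (simp add: g_def power_lmod_def)
    then have "c (f x) b = \<zero>\<^bsub>R\<^esub>" for b using supp[OF x(1)] s by (cases "b \<in> S") auto
    then have "f x = \<zero>\<^bsub>F\<^esub>" using c(3) f.hom_closed x(1) by blast
    then show ?thesis using f x(1) inj_hom_iff[OF F.left_module_axioms f(1)] by blast
  qed
  then have "inj_on g (carrier M)" using inj_hom_iff[OF R.power_left_module g] by blast
  with g show ?thesis by (rule that)
qed

text \<open>The projection followed by an embedding of the quotient into a power has kernel
  \<open>K\<close>. Recording this as a map on \<open>M\<close> removes both the quotient and the
  type \<open>'f\<close> from later arguments.\<close>

lemma embeds_in_power_kernel: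
  assumes K: "submodule K R M" and "fin_gen_lmod R M"
    and "embeds_in_free TYPE('f) R (quot_lmod M K)"
  obtains k g where "g \<in> lmod_hom R M (power_lmod R k)" "lmod_kernel M (power_lmod R k) g = K"
proof -
  interpret Q: left_module R "quot_lmod M K" using K by (rule quot_left_module)
  interpret \<pi>: left_module_hom R M "quot_lmod M K" "\<lambda>x. K +>\<^bsub>M\<^esub> x"
    by unfold_locales (rule quot_hom[OF K])
  have "fin_gen_lmod R (quot_lmod M K)"
    using assms(2) by (rule \<pi>.fin_gen_image) (simp add: carrier_quot_lmod[OF K])
  then obtain k h where h: "h \<in> lmod_hom R (quot_lmod M K) (power_lmod R k)"
      "inj_on h (carrier (quot_lmod M K))"
    using Q.embeds_in_power assms(3) by blast
  have "h X = \<zero>\<^bsub>power_lmod R k\<^esub> \<longleftrightarrow> X = \<zero>\<^bsub>quot_lmod M K\<^esub>" if "X \<in> carrier (quot_lmod M K)" for X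
  proof -
    interpret h: left_module_hom R "quot_lmod M K" "power_lmod R k" h
      by (intro left_module_hom.intro left_module_hom_axioms.intro Q.left_module_axioms
          R.power_left_module h)
    show ?thesis
      using Q.inj_hom_iff[OF R.power_left_module h(1)] h(2) that h.hom_zero by blast
  qed
  then have "lmod_kernel M (power_lmod R k) (h \<circ> (\<lambda>x. K +>\<^bsub>M\<^esub> x)) = K"
    using quot_kernel[OF K] \<pi>.hom_closed by (simp add: lmod_kernel_def cong: conj_cong)
  then show ?thesis using that lmod_hom_comp[OF \<pi>.hom h(1)] by blast
qed

end

section \<open>CF-, FGF- and IF-rings\<close>

context ring
begin

text \<open>The quotient of \<open>R\<close> by \<open>I\<close> is cyclic, as an image of
  \<open>R\<close>, and has its carrier in \<open>'a set\<close>, so the hypothesis applies to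
  it.\<close>

lemma left_CF_ring_ideal_kernel:
  assumes "left_CF_ring TYPE('a set) TYPE('f) R" and I: "left_ideal I R"
  obtains k g where "g \<in> lmod_hom R (regular_lmod R) (power_lmod R k)"
    "lmod_kernel (regular_lmod R) (power_lmod R k) g = I"
proof -
  interpret L: left_module R "regular_lmod R" by (rule regular_left_module)
  have I': "submodule I R (regular_lmod R)" using I by (simp add: left_ideal_def)
  let ?Q = "quot_lmod (regular_lmod R) I"
  interpret Q: left_module R ?Q using I' by (rule L.quot_left_module)
  interpret \<pi>: left_module_hom R "regular_lmod R" ?Q "\<lambda>a. I +>\<^bsub>regular_lmod R\<^esub> a"
    by unfold_locales (rule L.quot_hom[OF I'])
  have "cyclic_lmod R ?Q"
    using cyclic_regular by (rule \<pi>.cyclic_image) (simp add: L.carrier_quot_lmod[OF I'])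
  then have "embeds_in_free TYPE('f) R ?Q"
    using assms(1) Q.left_module_axioms by (simp add: left_CF_ring_def)
  with that L.embeds_in_power_kernel[OF I' L.cyclic_imp_fin_gen[OF cyclic_regular]] show ?thesis by blast
qed

lemma coherent_CF_imp_noetherian:
  assumes "left_coherent R" "left_CF_ring TYPE('a set) TYPE('f) R"
  shows "left_noetherian R"
  unfolding left_noetherian_def
proof (intro allI impI)
  fix I assume "left_ideal I R"
  then obtain k g where "g \<in> lmod_hom R (regular_lmod R) (power_lmod R k)"
    "lmod_kernel (regular_lmod R) (power_lmod R k) g = I"
    using left_CF_ring_ideal_kernel[OF assms(2)] by blast
  with left_coherent_kernel[OF assms(1)] show "fin_gen_lmod R ((regular_lmod R)\<lparr>carrier := I\<rparr>)"
    by blast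
qed

text \<open>A cyclic module on any carrier type is \<open>R\<close> modulo the annihilator of a
  generator \<open>x\<close>. That left ideal is the kernel of a map to some \<open>R^k\<close>,
  which descends to an embedding of \<open>M\<close>; some coordinate is then non-zero at
  \<open>y\<close>.\<close>

lemma left_CF_ring_cyclic_torsionless:
  fixes M :: "('a, 'm, 's) module_scheme"
  assumes CF: "left_CF_ring TYPE('a set) TYPE('f) R"
    and M: "left_module R M" "cyclic_lmod R M" and y: "y \<in> carrier M" "y \<noteq> \<zero>\<^bsub>M\<^esub>"
  obtains f where "f \<in> lmod_hom R M (regular_lmod R)" "f y \<noteq> \<zero>"
proof -
  interpret M: left_module R M by fact
  interpret L: left_module R "regular_lmod R" by (rule regular_left_module)
  obtain x where x: "x \<in> carrier M" "carrier M = lmod_span R M {x}"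
    using M(2) by (auto simp: cyclic_lmod_def)
  have "(\<lambda>a. a \<odot>\<^bsub>M\<^esub> x) \<in> lmod_hom R (regular_lmod R) M"
    using x(1) by (intro lmod_homI)
      (simp_all add: regular_lmod_def M.smult_closed M.smult_l_distr M.smult_assoc)
  then interpret p: left_module_hom R "regular_lmod R" M "\<lambda>a. a \<odot>\<^bsub>M\<^esub> x" by unfold_locales
  have surj: "(\<lambda>a. a \<odot>\<^bsub>M\<^esub> x) ` carrier (regular_lmod R) = carrier M"
    using x M.span_singleton[OF x(1)] by (simp add: regular_lmod_def)
  have "left_ideal (lmod_kernel (regular_lmod R) M (\<lambda>a. a \<odot>\<^bsub>M\<^esub> x)) R"
    unfolding left_ideal_def by (rule p.kernel_submodule)
  then obtain k g where g: "g \<in> lmod_hom R (regular_lmod R) (power_lmod R k)"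
    "lmod_kernel (regular_lmod R) (power_lmod R k) g
      = lmod_kernel (regular_lmod R) M (\<lambda>a. a \<odot>\<^bsub>M\<^esub> x)"
    using left_CF_ring_ideal_kernel[OF CF] by blast
  obtain h where h: "h \<in> lmod_hom R M (power_lmod R k)" "inj_on h (carrier M)"
    using p.factor_through_surjection[OF power_left_module surj g] by blast
  then have "h y \<noteq> \<zero>\<^bsub>power_lmod R k\<^esub>"
    using M.inj_hom_iff[OF power_left_module h(1)] y by blast
  then obtain i where "h y i \<noteq> \<zero>" by (auto simp: power_lmod_def)
  then show ?thesis using that[of "(\<lambda>v. v i) \<circ> h"] lmod_hom_comp[OF h(1) coord_hom] by simp
qed

lemma left_CF_ring_imp_kasch:
  assumes CF: "left_CF_ring TYPE('a set) TYPE('f) R"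
  shows "left_kasch_ring TYPE('m) TYPE('e) R"
  unfolding left_kasch_ring_def
proof (intro conjI allI impI)
  fix E :: "('a, 'e) module" assume hull: "injective_hull TYPE('m) R (regular_lmod R) E"
  then show inj: "injective_lmod TYPE('m) R E" by (simp add: injective_hull_def)
  interpret E: left_module R E using inj by (simp add: injective_lmod_def)
  interpret L: left_module R "regular_lmod R" by (rule regular_left_module)
  obtain i where i: "i \<in> lmod_hom R (regular_lmod R) E" "inj_on i (carrier (regular_lmod R))"
    using hull by (auto simp: injective_hull_def)
  have "\<exists>h\<in>lmod_hom R N E. \<exists>x\<in>carrier M. h (f x) \<noteq> h (g x)"
    if f: "f \<in> lmod_hom R M N" and g: "g \<in> lmod_hom R M N" and M: "left_module R M"
      and N: "left_module R N" and x: "x \<in> carrier M" "f x \<noteq> g x"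
    for M N :: "('a, 'm) module" and f g x
  proof -
    interpret M: left_module R M by fact
    interpret N: left_module R N by fact
    interpret f: left_module_hom R M N f by unfold_locales fact
    interpret g: left_module_hom R M N g by unfold_locales fact
    \<comment> \<open>Any \<open>h\<close> that does not kill this difference tells \<open>f\<close>
      and \<open>g\<close> apart at \<open>x\<close>.\<close>
    define y where "y = f x \<ominus>\<^bsub>N\<^esub> g x"
    have fg: "f x \<in> carrier N" "g x \<in> carrier N" using x f.hom_closed g.hom_closed by auto
    then have y: "y \<in> carrier N" "y \<noteq> \<zero>\<^bsub>N\<^esub>"
      using x by (simp_all add: y_def N.minus_eq_zero_iff)
    let ?Y = "lmod_span R N {y}"
    have Y: "submodule ?Y R N" using y by (intro N.span_submodule) simp
    have yY: "y \<in> ?Y" using N.span_superset[of "{y}"] by simp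
    interpret Y: left_module R "N\<lparr>carrier := ?Y\<rparr>" using Y by (rule N.submodule_left_module)
    have "cyclic_lmod R (N\<lparr>carrier := ?Y\<rparr>)"
      using yY N.span_restrict[OF Y, of "{y}"] by (auto simp: cyclic_lmod_def)
    then obtain t where t: "t \<in> lmod_hom R (N\<lparr>carrier := ?Y\<rparr>) (regular_lmod R)" "t y \<noteq> \<zero>"
      using left_CF_ring_cyclic_torsionless[OF CF Y.left_module_axioms, of y] y yY by auto
    \<comment> \<open>\<open>i\<close> embeds \<open>R\<close> into \<open>E\<close>, so composing
      with it keeps the functional non-zero at \<open>y\<close>.\<close>
    have "i (t y) \<noteq> \<zero>\<^bsub>E\<^esub>"
    proof -
      have "t y \<in> carrier (regular_lmod R)" using t(1) yY by (auto simp: lmod_hom_def hom_def)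
      then show ?thesis
        using L.inj_hom_iff[OF E.left_module_axioms i(1)] i(2) t(2) by (auto simp: regular_lmod_def)
    qed
    \<comment> \<open>\<open>N\<close> has its carrier in \<open>'m\<close>, the type for which
      \<open>E\<close> is injective, so the map on \<open>R y\<close> extends to
      \<open>N\<close>.\<close>
    moreover obtain h where h: "h \<in> lmod_hom R N E" "\<forall>z\<in>?Y. h z = (i \<circ> t) z"
      using inj lmod_hom_comp[OF t(1) i(1)] N Y unfolding injective_lmod_def by blast
    ultimately have "h y \<noteq> \<zero>\<^bsub>E\<^esub>" using yY by simp
    interpret h: left_module_hom R N E h by unfold_locales (rule h)
    have "h (f x) \<noteq> h (g x)"
      using \<open>h y \<noteq> \<zero>\<^bsub>E\<^esub>\<close> fg h.eq_iff_diff_in_kernel[OF fg] by (simp add: y_def lmod_kernel_def)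
    with h(1) x(1) show ?thesis by blast
  qed
  then show "cogenerator_lmod TYPE('m) R E"
    unfolding cogenerator_lmod_def using E.left_module_axioms by blast
next
  fix M :: "('a, 'm) module"
  assume M: "left_module R M" "cyclic_lmod R M" "carrier M \<noteq> {\<zero>\<^bsub>M\<^esub>}"
  interpret M: left_module R M by fact
  obtain y where "y \<in> carrier M" "y \<noteq> \<zero>\<^bsub>M\<^esub>" using M(3) M.M.zero_closed by blast
  then show "\<exists>f\<in>lmod_hom R M (regular_lmod R). \<exists>x\<in>carrier M. f x \<noteq> \<zero>"
    using left_CF_ring_cyclic_torsionless[OF CF M(1,2)] by metis
qed

text \<open>The kernel of a cover of \<open>M\<close> by \<open>R^n\<close> is a submodule of
  \<open>R^n\<close>, finitely generated by \<open>left_noetherian_power\<close>.\<close>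

lemma noetherian_fin_gen_imp_fin_pres:
  assumes "left_noetherian R" "left_module R M" "fin_gen_lmod R M"
  shows "fin_pres_lmod R M"
proof -
  interpret M: left_module R M by fact
  obtain n f where f: "f \<in> lmod_hom R (power_lmod R n) M"
      "f ` carrier (power_lmod R n) = carrier M"
    using M.fin_gen_power_cover[OF assms(3)] .
  interpret P: left_module R "power_lmod R n" by (rule power_left_module)
  interpret f: left_module_hom R "power_lmod R n" M f by unfold_locales (rule f)
  show ?thesis
    unfolding fin_pres_lmod_def
    using f left_noetherian_power[OF assms(1) f.kernel_submodule] by blast
qed

text \<open>Replaces a finitely generated module over an arbitrary carrier type by its copy \<open>R\<^sup>n/K\<close>.\<close>

lemma left_FGF_ring_all_types:
  assumes FGF: "left_FGF_ring TYPE((nat \<Rightarrow> 'a) set) TYPE('f) R"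
  shows "left_FGF_ring TYPE('m) TYPE(nat \<Rightarrow> 'a) R"
  unfolding left_FGF_ring_def
proof (intro allI impI)
  fix M :: "('a, 'm) module" assume M: "left_module R M" "fin_gen_lmod R M"
  interpret M: left_module R M by fact
  obtain n f where f: "f \<in> lmod_hom R (power_lmod R n) M"
      "f ` carrier (power_lmod R n) = carrier M"
    using M.fin_gen_power_cover[OF M(2)] .
  interpret P: left_module R "power_lmod R n" by (rule power_left_module)
  interpret f: left_module_hom R "power_lmod R n" M f by unfold_locales (rule f)
  let ?K = "lmod_kernel (power_lmod R n) M f"
  let ?Q = "quot_lmod (power_lmod R n) ?K"
  note K = f.kernel_submodule
  interpret Q: left_module R ?Q using K by (rule P.quot_left_module)
  interpret \<pi>: left_module_hom R "power_lmod R n" ?Q "\<lambda>v. ?K +>\<^bsub>power_lmod R n\<^esub> v"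
    by unfold_locales (rule P.quot_hom[OF K])
  have fg: "fin_gen_lmod R (power_lmod R n)" by (rule fin_gen_power)
  then have "fin_gen_lmod R ?Q"
    by (rule \<pi>.fin_gen_image) (simp add: P.carrier_quot_lmod[OF K])
  then have "embeds_in_free TYPE('f) R ?Q"
    using FGF Q.left_module_axioms by (simp add: left_FGF_ring_def)
  then obtain k g where g: "g \<in> lmod_hom R (power_lmod R n) (power_lmod R k)"
      "lmod_kernel (power_lmod R n) (power_lmod R k) g = ?K"
    using P.embeds_in_power_kernel[OF K fg] by blast
  \<comment> \<open>\<open>M\<close> is itself \<open>R^n\<close> modulo \<open>?K\<close>, so
    \<open>g\<close> descends to an embedding of \<open>M\<close>.\<close>
  obtain h where "h \<in> lmod_hom R M (power_lmod R k)" "inj_on h (carrier M)"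
    using f.factor_through_surjection[OF power_left_module f(2) g] by blast
  then show "embeds_in_free TYPE(nat \<Rightarrow> 'a) R M"
    unfolding embeds_in_free_def using power_lmod_free by blast
qed

lemma left_FGF_imp_CF_ring:
  "left_FGF_ring TYPE('m) TYPE('f) R \<Longrightarrow> left_CF_ring TYPE('m) TYPE('f) R"
  by (auto simp: left_FGF_ring_def left_CF_ring_def left_module.cyclic_imp_fin_gen)

lemma left_FGF_imp_IF_ring:
  "left_FGF_ring TYPE('m) TYPE('f) R \<Longrightarrow> left_IF_ring TYPE('m) TYPE('f) R"
  by (auto simp: left_FGF_ring_def left_IF_ring_def left_module.fin_pres_imp_fin_gen)

text \<open>Over a left noetherian ring both notions quantify over the same modules.\<close>

lemma noetherian_IF_imp_FGF_ring:
  "\<lbrakk>left_noetherian R; left_IF_ring TYPE('m) TYPE('f) R\<rbrakk> \<Longrightarrow> left_FGF_ring TYPE('m) TYPE('f) R"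
  by (auto simp: left_FGF_ring_def left_IF_ring_def noetherian_fin_gen_imp_fin_pres)

end

theorem lemma2p10:
  fixes R :: "('a, 'r) ring_scheme"
  assumes "ring R"
  shows "(left_coherent R \<and> left_CF_ring TYPE('a set) TYPE('f) R \<longrightarrow>
            left_noetherian R \<and> left_kasch_ring TYPE('m) TYPE('e) R) \<and>
         (left_noetherian R \<and> left_IF_ring TYPE((nat \<Rightarrow> 'a) set) TYPE('f) R \<longrightarrow>
            left_FGF_ring TYPE('m) TYPE(nat \<Rightarrow> 'a) R) \<and>
         (left_coherent R \<and> left_FGF_ring TYPE((nat \<Rightarrow> 'a) set) TYPE('f) R \<longrightarrow>
            left_noetherian R \<and> left_IF_ring TYPE('m) TYPE(nat \<Rightarrow> 'a) R)"
proof (intro conjI impI; elim conjE)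
  interpret ring R by fact
  assume coh: "left_coherent R"
  show "left_noetherian R" if CF: "left_CF_ring TYPE('a set) TYPE('f) R"
    using coh CF by (rule coherent_CF_imp_noetherian)
  \<comment> \<open>\<open>coherent_CF_imp_noetherian\<close> wants cyclic modules carried by
    \<open>'a set\<close>, while the hypothesis concerns \<open>(nat \<Rightarrow> 'a) set\<close>;
    \<open>left_FGF_ring_all_types\<close> bridges the two.\<close>
  show "left_noetherian R" if FGF: "left_FGF_ring TYPE((nat \<Rightarrow> 'a) set) TYPE('f) R"
    using coh left_FGF_imp_CF_ring[OF left_FGF_ring_all_types[OF FGF]]
    by (rule coherent_CF_imp_noetherian)
next
  interpret ring R by fact
  show "left_kasch_ring TYPE('m) TYPE('e) R" if "left_CF_ring TYPE('a set) TYPE('f) R"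
    using that by (rule left_CF_ring_imp_kasch)
  \<comment> \<open>The IF hypothesis first becomes FGF at its own types; then the types are
    changed.\<close>
  show "left_FGF_ring TYPE('m) TYPE(nat \<Rightarrow> 'a) R"
    if "left_noetherian R" "left_IF_ring TYPE((nat \<Rightarrow> 'a) set) TYPE('f) R"
    using noetherian_IF_imp_FGF_ring[OF that] by (rule left_FGF_ring_all_types)
  show "left_IF_ring TYPE('m) TYPE(nat \<Rightarrow> 'a) R"
    if "left_FGF_ring TYPE((nat \<Rightarrow> 'a) set) TYPE('f) R"
    using left_FGF_ring_all_types[OF that] by (rule left_FGF_imp_IF_ring)
qed

end
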